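(* Let $H=\mathbb{R}^n$, let $Z=(Z_t)$ be an $n$-dimensional symmetric non-degenerate $\alpha$-stable process with $\alpha\in(0,2)$, and let $A$ be any real $n\times n$ matrix. Then the Ornstein–Uhlenbeck process starting at $0$, $$Z_A(t)=\int_0^te^{A(t-s)}\,dZ_s,$$ is irreducible; i.e., for any $t>0$ the support of the distribution of $Z_A(t)$ is $H$.
   Context: Symmetric non-degenerate $\alpha$-stable process on $\mathbb{R}^n$: a Lévy process $Z=(Z_t)$ with $\mathbb{E}[e^{i\langle Z_t,u\rangle}]=e^{-t\psi(u)}$, $u\in\mathbb{R}^n$, where $$\psi(u)=-\int_{\mathbb{R}^n}\big(e^{i\langle u,y\rangle}-1-i\langle u,y\rangle 1_{\{|y|\le1\}}(y)\big)\,\nu(dy),$$ and the Lévy measure is $\nu(D)=\int_S\mu(d\xi)\int_0^\infty 1_D(r\xi)\frac{dr}{r^{1+\alpha}}$ for Borel $D\subset\mathbb{R}^n$, with $\mu$ a symmetric, non-zero finite measure on the unit sphere $S$ of $\mathbb{R}^n$. Non-degeneracy means that there is $C_\alpha>0$ with $\psi(u)\ge C_\alpha|u|^\alpha$ for all $u\in\mathbb{R}^n$ (equivalently, the support of $\mu$ is not contained in a proper linear subspace of $\mathbb{R}^n$). *)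

theory Defs
  imports "HOL-Probability.Probability"
begin

section \<open>Levy processes\<close>

text \<open>Time is the half-line \<open>{0..}\<close>; the values of \<open>Z\<close> at negative times are irrelevant.\<close>

locale levy_process = prob_space M for M :: "'w measure" +
  fixes Z :: "real \<Rightarrow> 'w \<Rightarrow> real ^ 'n"
  assumes random_variable_Z: "\<And>t. 0 \<le> t \<Longrightarrow> random_variable borel (Z t)"
    and start_zero: "AE \<omega> in M. Z 0 \<omega> = 0"
    and independent_increments:
      "\<And>(N::nat) s. \<lbrakk>0 \<le> s 0; \<And>i. i < N \<Longrightarrow> s i \<le> s (Suc i)\<rbrakk> \<Longrightarrow>
         indep_vars (\<lambda>_. borel) (\<lambda>i \<omega>. Z (s (Suc i)) \<omega> - Z (s i) \<omega>) {..<N}"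
    and stationary_increments:
      "\<And>s h. \<lbrakk>0 \<le> s; 0 \<le> h\<rbrakk> \<Longrightarrow>
         distr M borel (\<lambda>\<omega>. Z (s + h) \<omega> - Z s \<omega>) = distr M borel (Z h)"
    and stochastically_continuous:
      "\<And>s \<epsilon>. \<lbrakk>0 \<le> s; 0 < \<epsilon>\<rbrakk> \<Longrightarrow>
         ((\<lambda>r. prob {\<omega> \<in> space M. \<epsilon> < norm (Z r \<omega> - Z s \<omega>)}) \<longlongrightarrow> 0) (at s within {0..})"
    and cadlag_paths:
      "AE \<omega> in M. (\<forall>t\<ge>0. continuous (at_right t) (\<lambda>s. Z s \<omega>)) \<and>
                   (\<forall>t>0. \<exists>l. ((\<lambda>s. Z s \<omega>) \<longlongrightarrow> l) (at_left t))"

section \<open>Symmetric stable processes\<close>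

definition symmetric_spherical_measure :: "(real ^ 'n) measure \<Rightarrow> bool" where
  "symmetric_spherical_measure \<mu> \<longleftrightarrow>
     sets \<mu> = sets (restrict_space borel (sphere 0 1)) \<and>
     finite_measure \<mu> \<and>
     emeasure \<mu> (space \<mu>) \<noteq> 0 \<and>
     (\<forall>D\<in>sets \<mu>. emeasure \<mu> (uminus ` D) = emeasure \<mu> D)"

definition stable_levy_measure :: "real \<Rightarrow> (real ^ 'n) measure \<Rightarrow> (real ^ 'n) measure" where
  "stable_levy_measure \<alpha> \<mu> = measure_of UNIV (sets borel)
     (\<lambda>D. \<integral>\<^sup>+\<xi>. (\<integral>\<^sup>+r\<in>{0<..}. indicator D (r *\<^sub>R \<xi>) * ennreal (1 / r powr (1 + \<alpha>)) \<partial>lborel) \<partial>\<mu>)"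

text \<open>The set function above is countably additive, so it is indeed the value of the measure
  built from it (\<open>measure_of\<close> would otherwise return the zero measure).\<close>

lemma sets_stable_levy_measure [simp]: "sets (stable_levy_measure \<alpha> \<mu>) = sets borel"
  unfolding stable_levy_measure_def
  using sets.sets_measure_of_eq [of borel] by simp

lemma emeasure_stable_levy_measure:
  fixes \<mu> :: "(real ^ 'n) measure"
  assumes \<mu>: "symmetric_spherical_measure \<mu>" and D: "D \<in> sets borel"
  shows "emeasure (stable_levy_measure \<alpha> \<mu>) D =
    (\<integral>\<^sup>+\<xi>. (\<integral>\<^sup>+r\<in>{0<..}. indicator D (r *\<^sub>R \<xi>) * ennreal (1 / r powr (1 + \<alpha>)) \<partial>lborel) \<partial>\<mu>)"
    (is "_ = ?m D")
proof -
  have [measurable]: "(\<lambda>\<xi>. \<xi>) \<in> measurable \<mu> borel"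
  proof -
    have "sets \<mu> = sets (restrict_space borel (sphere 0 1))"
      using \<mu> by (simp add: symmetric_spherical_measure_def)
    then show ?thesis
      by (simp cong: measurable_cong_sets add: measurable_restrict_space1)
  qed
  have meas: "(\<lambda>\<xi>. \<integral>\<^sup>+r\<in>{0<..}. indicator B (r *\<^sub>R \<xi>) * ennreal (1 / r powr (1 + \<alpha>)) \<partial>lborel)
      \<in> borel_measurable \<mu>" if [measurable]: "B \<in> sets borel" for B
    by measurable
  have "countably_additive (sets borel) ?m"
  proof (rule countably_additiveI)
    fix A :: "nat \<Rightarrow> (real ^ 'n) set"
    assume A: "range A \<subseteq> sets borel" "disjoint_family A"
    have [measurable]: "A i \<in> sets borel" for i
      using A by auto
    have "(\<Sum>i. ?m (A i)) = (\<integral>\<^sup>+\<xi>. (\<Sum>i. \<integral>\<^sup>+r\<in>{0<..}. indicator (A i) (r *\<^sub>R \<xi>) * ennreal (1 / r powr (1 + \<alpha>)) \<partial>lborel) \<partial>\<mu>)"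
      by (rule nn_integral_suminf [symmetric]) (rule meas, measurable)
    also have "\<dots> = (\<integral>\<^sup>+\<xi>. (\<integral>\<^sup>+r. (\<Sum>i. indicator (A i) (r *\<^sub>R \<xi>) * ennreal (1 / r powr (1 + \<alpha>)) * indicator {0<..} r) \<partial>lborel) \<partial>\<mu>)"
      by (intro nn_integral_cong nn_integral_suminf [symmetric]) measurable
    also have "\<dots> = ?m (\<Union>i. A i)"
      by (simp add: suminf_indicator [OF A(2), symmetric])
    finally show "(\<Sum>i. ?m (A i)) = ?m (\<Union>i. A i)" .
  qed
  moreover have "positive (sets borel) ?m"
    by (simp add: positive_def)
  ultimately show ?thesis
    by (intro emeasure_measure_of [OF stable_levy_measure_def]) (use D in auto)
qed

definition stable_exponent :: "real \<Rightarrow> (real ^ 'n) measure \<Rightarrow> real ^ 'n \<Rightarrow> complex" where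
  "stable_exponent \<alpha> \<mu> u =
     - (CLINT y | stable_levy_measure \<alpha> \<mu>.
          iexp (u \<bullet> y) - 1 - \<i> * complex_of_real ((u \<bullet> y) * indicator {y. norm y \<le> 1} y))"

locale symmetric_stable_process = levy_process M Z
  for M :: "'w measure" and Z :: "real \<Rightarrow> 'w \<Rightarrow> real ^ 'n" +
  fixes \<alpha> :: real and \<mu> :: "(real ^ 'n) measure"
  assumes spherical_measure: "symmetric_spherical_measure \<mu>"
    and characteristic_function:
      "\<And>t u. 0 \<le> t \<Longrightarrow>
         (CLINT \<omega> | M. iexp (Z t \<omega> \<bullet> u)) = exp (- complex_of_real t * stable_exponent \<alpha> \<mu> u)"

text \<open>By symmetry of \<open>\<mu>\<close> the exponent is real-valued; \<open>Re\<close> only changes its type.\<close>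

locale nondegenerate_symmetric_stable_process = symmetric_stable_process +
  assumes nondegenerate: "\<exists>C>0. \<forall>u. C * norm u powr \<alpha> \<le> Re (stable_exponent \<alpha> \<mu> u)"

section \<open>Integrals of deterministic matrix functions\<close>

text \<open>The stochastic integral is the limit in probability of the Riemann sums as the mesh of
  the partition \<open>a = s 0 \<le> \<dots> \<le> s N = b\<close> tends to \<open>0\<close>. It is unique up to almost sure equality.\<close>

definition has_stochastic_integral ::
  "'w measure \<Rightarrow> (real \<Rightarrow> 'w \<Rightarrow> real ^ 'n) \<Rightarrow> (real \<Rightarrow> real ^ 'n ^ 'n) \<Rightarrow> real \<Rightarrow> real
     \<Rightarrow> ('w \<Rightarrow> real ^ 'n) \<Rightarrow> bool" where
  "has_stochastic_integral M Z F a b X \<longleftrightarrow>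
     X \<in> borel_measurable M \<and>
     (\<forall>\<epsilon>>0. \<forall>\<eta>>0. \<exists>\<delta>>0. \<forall>(N::nat) s.
        s 0 = a \<and> s N = b \<and> (\<forall>i<N. s i \<le> s (Suc i) \<and> s (Suc i) - s i < \<delta>) \<longrightarrow>
        measure M {\<omega> \<in> space M.
          \<epsilon> < norm ((\<Sum>i<N. F (s i) *v (Z (s (Suc i)) \<omega> - Z (s i) \<omega>)) - X \<omega>)} < \<eta>)"

definition stochastic_integral ::
  "'w measure \<Rightarrow> (real \<Rightarrow> 'w \<Rightarrow> real ^ 'n) \<Rightarrow> (real \<Rightarrow> real ^ 'n ^ 'n) \<Rightarrow> real \<Rightarrow> real
     \<Rightarrow> 'w \<Rightarrow> real ^ 'n" where
  "stochastic_integral M Z F a b = (SOME X. has_stochastic_integral M Z F a b X)"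

section \<open>Ornstein--Uhlenbeck processes\<close>

text \<open>The library's \<open>exp\<close> and \<open>^\<close> do not apply here: the type-class product on \<open>real ^ 'n ^ 'n\<close>
  is componentwise.\<close>

definition matrix_exp :: "real ^ 'n ^ 'n \<Rightarrow> real ^ 'n ^ 'n" where
  "matrix_exp A = (\<Sum>k. (1 / fact k) *\<^sub>R ((\<lambda>B. A ** B) ^^ k) (mat 1))"

definition ornstein_uhlenbeck ::
  "'w measure \<Rightarrow> (real \<Rightarrow> 'w \<Rightarrow> real ^ 'n) \<Rightarrow> real ^ 'n ^ 'n \<Rightarrow> real \<Rightarrow> 'w \<Rightarrow> real ^ 'n" where
  "ornstein_uhlenbeck M Z A t =
     stochastic_integral M Z (\<lambda>s. matrix_exp ((t - s) *\<^sub>R A)) 0 t"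

definition measure_support :: "'a::topological_space measure \<Rightarrow> 'a set" where
  "measure_support \<nu> = {x. \<forall>U. open U \<and> x \<in> U \<longrightarrow> 0 < emeasure \<nu> U}"

definition irreducible_process ::
  "'w measure \<Rightarrow> (real \<Rightarrow> 'w \<Rightarrow> 'a::topological_space) \<Rightarrow> bool" where
  "irreducible_process M X \<longleftrightarrow> (\<forall>t>0. measure_support (distr M borel (X t)) = UNIV)"

end

theory Submission
  imports Defs "HOL-Real_Asymp.Real_Asymp"
begin

text \<open>Integration by parts along cadlag paths shows that the stochastic integral exists. Its
  characteristic function is a limit of products of powers of the one of \<open>Z\<close>; hence it is
  \<open>exp (- \<Psi>)\<close> with \<open>\<Psi>\<close> even, homogeneous of degree \<open>\<alpha>\<close> and bounded below by a multiple of
  \<open>norm u powr \<alpha>\<close>, i.e. the integral is itself a non-degenerate symmetric \<open>\<alpha>\<close>-stable vector.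

  The support \<open>S\<close> of such a law satisfies \<open>S = - S\<close> and \<open>a S + b S \<subseteq> S\<close> whenever
  \<open>a powr \<alpha> + b powr \<alpha> = 1\<close>. Therefore \<open>S\<close> is star-shaped, and the union \<open>T\<close> of the lines through
  \<open>0\<close> contained in \<open>S\<close> is a linear subspace with \<open>S + T \<subseteq> S\<close>. A closed star-shaped set without
  lines is bounded, so \<open>S\<close> is bounded modulo \<open>T\<close>. If \<open>T\<close> were proper, the law would be bounded in
  some direction, so its characteristic function would be \<open>1 - O(s\<^sup>2)\<close> along that direction,
  which contradicts \<open>\<alpha> < 2\<close>.\<close>

section \<open>The matrix exponential\<close>

definition matrix_pow :: "real ^ 'n ^ 'n \<Rightarrow> nat \<Rightarrow> real ^ 'n ^ 'n" where
  "matrix_pow A k = ((\<lambda>B. A ** B) ^^ k) (mat 1)"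

lemma matrix_pow_0 [simp]: "matrix_pow A 0 = mat 1"
  and matrix_pow_Suc: "matrix_pow A (Suc k) = A ** matrix_pow A k"
  by (simp_all add: matrix_pow_def)

lemma matrix_pow_commute: "A ** matrix_pow A k = matrix_pow A k ** A"
  by (induction k) (simp_all add: matrix_pow_Suc matrix_mul_assoc)

lemma matrix_mult_scaleR_left: "(s *\<^sub>R A) ** B = s *\<^sub>R (A ** B)"
  for A :: "real ^ 'n ^ 'n"
  by (simp add: vec_eq_iff matrix_matrix_mult_def sum_distrib_left mult_ac)

lemma matrix_mult_scaleR_right: "A ** (s *\<^sub>R B) = s *\<^sub>R (A ** B)"
  for A :: "real ^ 'n ^ 'n"
  by (simp add: vec_eq_iff matrix_matrix_mult_def sum_distrib_left mult_ac)

lemma matrix_pow_scaleR: "matrix_pow (s *\<^sub>R A) k = s ^ k *\<^sub>R matrix_pow A k"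
  by (induction k) (simp_all add: matrix_pow_Suc matrix_mult_scaleR_left matrix_mult_scaleR_right)

text \<open>The sum of the absolute entries of \<open>A\<close> dominates each of its row sums, so
  each further factor \<open>A\<close> costs at most one further factor of it. This majorises the
  exponential series entrywise by a scalar one.\<close>

lemma abs_matrix_pow_le:
  fixes A :: "real ^ 'n ^ 'n"
  shows "\<bar>matrix_pow A k $ i $ j\<bar> \<le> (\<Sum>i\<in>UNIV. \<Sum>j\<in>UNIV. \<bar>A $ i $ j\<bar>) ^ k"
proof (induction k arbitrary: i j)
  case 0
  then show ?case by (simp add: mat_def)
next
  case (Suc k)
  let ?K = "\<Sum>i\<in>UNIV. \<Sum>j\<in>UNIV. \<bar>A $ i $ j\<bar>"
  have "\<bar>matrix_pow A (Suc k) $ i $ j\<bar> \<le> (\<Sum>l\<in>UNIV. \<bar>A $ i $ l\<bar> * \<bar>matrix_pow A k $ l $ j\<bar>)"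
    by (simp add: matrix_pow_Suc matrix_matrix_mult_def abs_mult [symmetric])
  also have "\<dots> \<le> (\<Sum>l\<in>UNIV. \<bar>A $ i $ l\<bar> * ?K ^ k)"
    by (intro sum_mono mult_left_mono Suc.IH) auto
  also have "\<dots> = (\<Sum>l\<in>UNIV. \<bar>A $ i $ l\<bar>) * ?K ^ k"
    by (simp add: sum_distrib_right)
  also have "\<dots> \<le> ?K * ?K ^ k"
    by (intro mult_right_mono zero_le_power sum_nonneg
        member_le_sum [of i UNIV "\<lambda>i. \<Sum>j\<in>UNIV. \<bar>A $ i $ j\<bar>"]) (auto intro: sum_nonneg)
  finally show ?case by simp
qed

lemma summable_matrix_exp:
  "summable (\<lambda>k. matrix_pow A k $ i $ j / fact k * s ^ k)"
proof (rule summable_comparison_test' [where N = 0])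
  let ?K = "\<Sum>i\<in>UNIV. \<Sum>j\<in>UNIV. \<bar>A $ i $ j\<bar>"
  show "summable (\<lambda>k. (?K * \<bar>s\<bar>) ^ k /\<^sub>R fact k)"
    by (rule summable_exp_generic)
  show "norm (matrix_pow A k $ i $ j / fact k * s ^ k) \<le> (?K * \<bar>s\<bar>) ^ k /\<^sub>R fact k" for k
    using mult_right_mono [OF abs_matrix_pow_le [of A k i j], of "\<bar>s\<bar> ^ k"]
    by (simp add: abs_mult power_mult_distrib power_abs divide_simps)
qed

text \<open>Reduces the calculus of the matrix exponential to scalar power series in
  \<open>s\<close>, which can be differentiated term by term.\<close>

lemma matrix_exp_nth:
  "matrix_exp (s *\<^sub>R A) $ i $ j = (\<Sum>k. matrix_pow A k $ i $ j / fact k * s ^ k)"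
proof -
  have "(\<lambda>k. (1 / fact k) *\<^sub>R matrix_pow (s *\<^sub>R A) k) sums
      (\<chi> i j. \<Sum>k. matrix_pow A k $ i $ j / fact k * s ^ k)"
    unfolding sums_def
    using summable_sums [OF summable_matrix_exp]
    by (intro vec_tendstoI) (simp add: sums_def matrix_pow_scaleR mult_ac)
  then show ?thesis
    by (simp add: matrix_exp_def matrix_pow_def [symmetric] sums_iff)
qed

lemma diffs_matrix_pow:
  "diffs (\<lambda>k. matrix_pow A k $ i $ j / fact k) k = matrix_pow A (Suc k) $ i $ j / fact k"
  by (simp add: diffs_def del: of_nat_Suc)

text \<open>By \<open>diffs_matrix_pow\<close> these are the terms of the differentiated series of
  an entry, so the sum found here is its derivative.\<close>

lemma sums_matrix_pow_Suc:
  "(\<lambda>k. matrix_pow A (Suc k) $ i $ j / fact k * s ^ k) sums (A ** matrix_exp (s *\<^sub>R A)) $ i $ j"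
proof -
  have "(\<lambda>k. \<Sum>l\<in>UNIV. A $ i $ l * (matrix_pow A k $ l $ j / fact k * s ^ k)) sums
      (\<Sum>l\<in>UNIV. A $ i $ l * (\<Sum>k. matrix_pow A k $ l $ j / fact k * s ^ k))"
    by (intro sums_sum sums_mult summable_sums summable_matrix_exp)
  also have "(\<lambda>k. \<Sum>l\<in>UNIV. A $ i $ l * (matrix_pow A k $ l $ j / fact k * s ^ k)) =
      (\<lambda>k. matrix_pow A (Suc k) $ i $ j / fact k * s ^ k)"
    by (rule ext) (simp add: matrix_pow_Suc matrix_matrix_mult_def sum_distrib_right sum_divide_distrib mult.assoc)
  finally show ?thesis
    unfolding matrix_matrix_mult_def [of A "matrix_exp _"] by (simp only: matrix_exp_nth vec_lambda_beta)
qed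

text \<open>Since \<open>A\<close> commutes with its powers, both products have the same series in
  every entry.\<close>

lemma matrix_exp_commute: "A ** matrix_exp (s *\<^sub>R A) = matrix_exp (s *\<^sub>R A) ** A"
proof -
  have "(\<lambda>k. matrix_pow A (Suc k) $ i $ j / fact k * s ^ k) sums (matrix_exp (s *\<^sub>R A) ** A) $ i $ j" for i j
  proof -
    have "(\<lambda>k. \<Sum>l\<in>UNIV. (matrix_pow A k $ i $ l / fact k * s ^ k) * A $ l $ j) sums
        (\<Sum>l\<in>UNIV. (\<Sum>k. matrix_pow A k $ i $ l / fact k * s ^ k) * A $ l $ j)"
      by (intro sums_sum sums_mult2 summable_sums summable_matrix_exp)
    also have "(\<lambda>k. \<Sum>l\<in>UNIV. (matrix_pow A k $ i $ l / fact k * s ^ k) * A $ l $ j) =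
        (\<lambda>k. matrix_pow A (Suc k) $ i $ j / fact k * s ^ k)"
      unfolding matrix_pow_Suc matrix_pow_commute
      by (rule ext) (simp add: matrix_matrix_mult_def sum_distrib_left sum_distrib_right sum_divide_distrib mult_ac)
    finally show ?thesis
      unfolding matrix_matrix_mult_def [of "matrix_exp _" A] by (simp only: matrix_exp_nth vec_lambda_beta)
  qed
  then have "(A ** matrix_exp (s *\<^sub>R A)) $ i $ j = (matrix_exp (s *\<^sub>R A) ** A) $ i $ j" for i j
    by (rule sums_unique2 [OF sums_matrix_pow_Suc])
  then show ?thesis
    by (simp add: vec_eq_iff)
qed

lemma has_real_derivative_matrix_exp:
  "((\<lambda>s. matrix_exp (s *\<^sub>R A) $ i $ j) has_real_derivative (A ** matrix_exp (s *\<^sub>R A)) $ i $ j) (at s)"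
  unfolding matrix_exp_nth
  using termdiffs_strong_converges_everywhere
    [of "\<lambda>k. matrix_pow A k $ i $ j / fact k" s, OF summable_matrix_exp]
  unfolding diffs_matrix_pow sums_unique [OF sums_matrix_pow_Suc, symmetric] .

lemma matrix_exp_0: "matrix_exp (0 :: real ^ 'n ^ 'n) = mat 1"
  using matrix_exp_nth [of 0 "0 :: real ^ 'n ^ 'n"] by (simp add: vec_eq_iff powser_zero del: times_divide_eq_left)

lemma continuous_on_matrix_exp:
  "continuous_on S (\<lambda>s. matrix_exp (s *\<^sub>R A))"
proof -
  have "continuous_on S (\<lambda>s. \<chi> i j. matrix_exp (s *\<^sub>R A) $ i $ j)"
    by (intro continuous_on_vec_lambda DERIV_continuous_on)
      (rule has_field_derivative_at_within [OF has_real_derivative_matrix_exp])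
  then show ?thesis by simp
qed

text \<open>The product has derivative zero in \<open>s\<close> and hence keeps its value at
  \<open>0\<close>. The inverse obtained here later bounds the transposed exponential from
  below.\<close>

lemma matrix_exp_mult_uminus:
  "matrix_exp (s *\<^sub>R A) ** matrix_exp ((- s) *\<^sub>R A) = mat 1"
proof -
  define h where "h i j s = (matrix_exp (s *\<^sub>R A) ** matrix_exp ((- s) *\<^sub>R A)) $ i $ j" for i j and s :: real
  let ?E = "\<lambda>s. matrix_exp (s *\<^sub>R A)"
  have "(h i j has_real_derivative 0) (at s)" for i j and s :: real
  proof -
    have "((\<lambda>s. ?E (- s) $ l $ j) has_real_derivative - (A ** ?E (- s)) $ l $ j) (at s)" for l
      using DERIV_chain' [OF DERIV_minus [OF DERIV_ident] has_real_derivative_matrix_exp [of A l j "- s"]]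
      by simp
    \<comment> \<open>The derivative of the first factor is written with \<open>A\<close> on the
      right, so that the two terms of the product rule cancel by associativity.\<close>
    note d = DERIV_mult [OF has_real_derivative_matrix_exp [unfolded matrix_exp_commute] this]
    have "(h i j has_real_derivative (\<Sum>l\<in>UNIV. (?E s ** A) $ i $ l * ?E (- s) $ l $ j
        + - (A ** ?E (- s)) $ l $ j * ?E s $ i $ l)) (at s)"
      unfolding h_def matrix_matrix_mult_def [of "?E _" "?E _"] vec_lambda_beta
      by (rule DERIV_sum) (rule d)
    also have "(\<Sum>l\<in>UNIV. (?E s ** A) $ i $ l * ?E (- s) $ l $ j
        + - (A ** ?E (- s)) $ l $ j * ?E s $ i $ l) =
        ((?E s ** A) ** ?E (- s)) $ i $ j - (?E s ** (A ** ?E (- s))) $ i $ j"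
      unfolding matrix_matrix_mult_def [of "?E s ** A" "?E (- s)"]
        matrix_matrix_mult_def [of "?E s" "A ** ?E (- s)"] vec_lambda_beta
      by (simp add: sum_subtractf mult.commute)
    finally show ?thesis
      by (simp add: matrix_mul_assoc)
  qed
  then have "h i j s = h i j 0" for i j
    by (intro DERIV_isconst_all) auto
  then show ?thesis
    by (simp add: vec_eq_iff h_def) (simp add: matrix_exp_0)
qed

section \<open>Riemann sums along right-continuous paths\<close>

lemma partition_mono:
  fixes s :: "nat \<Rightarrow> real"
  assumes "\<And>i. i < N \<Longrightarrow> s i \<le> s (Suc i)" and "i \<le> j" and "j \<le> N"
  shows "s i \<le> s j"
  using assms(2,3)
proof (induction j rule: dec_induct)
  case (step j)
  with assms(1) [of j] show ?case by simp
qed simp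

lemma sum_by_parts:
  fixes f z :: "real \<Rightarrow> real" and s :: "nat \<Rightarrow> real"
  shows "(\<Sum>i<N. f (s i) * (z (s (Suc i)) - z (s i))) =
    f (s N) * z (s N) - f (s 0) * z (s 0) - (\<Sum>i<N. (f (s (Suc i)) - f (s i)) * z (s (Suc i)))"
  by (induction N) (simp_all add: algebra_simps)

text \<open>The intervals are left-open, and repeated partition points give empty ones, so exactly
  one contains \<open>r\<close>. The last clause evaluates a step function there.\<close>

lemma partition_interval:
  fixes s :: "nat \<Rightarrow> real"
  assumes s: "\<And>i. i < N \<Longrightarrow> s i \<le> s (Suc i)" and r: "s 0 < r" "r \<le> s N"
  obtains i where "i < N" "s i < r" "r \<le> s (Suc i)"
    "\<And>h :: nat \<Rightarrow> real. (\<Sum>j<N. indicator {s j<..s (Suc j)} r * h j) = h i"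
proof -
  \<comment> \<open>\<open>m\<close> belongs to the first partition point that is not left of
    \<open>r\<close>. It is positive because \<open>s 0 < r\<close>, and its predecessor is the
    wanted index.\<close>
  define m where "m = (LEAST j. r \<le> s j)"
  have m: "r \<le> s m" "m \<le> N"
    unfolding m_def using r(2) by (fact LeastI, rule Least_le)
  obtain i where i: "m = Suc i"
    using m(1) r(1) by (cases m) auto
  have "\<not> r \<le> s i"
    by (rule not_less_Least) (fold m_def, simp add: i)
  then have "s i < r"
    by (rule not_le_imp_less)
  have other: "r \<notin> {s j<..s (Suc j)}" if "j < N" "j \<noteq> i" for j
  proof (cases "j < i")
    case True
    then have "s (Suc j) \<le> s i"
      using m i by (auto intro: partition_mono [of N s, OF s])
    with \<open>s i < r\<close> show ?thesis by auto
  next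
    case False
    with that have "s (Suc i) \<le> s j"
      by (auto intro: partition_mono [of N s, OF s])
    with m i show ?thesis by auto
  qed
  show thesis
  proof
    show "i < N" "s i < r" "r \<le> s (Suc i)"
      using m i \<open>s i < r\<close> by auto
    show "(\<Sum>j<N. indicator {s j<..s (Suc j)} r * h j) = h i" for h :: "nat \<Rightarrow> real"
    proof -
      have "(\<Sum>j<N. indicator {s j<..s (Suc j)} r * h j) = (\<Sum>j\<in>{i}. indicator {s j<..s (Suc j)} r * h j)"
        using \<open>i < N\<close> by (intro sum.mono_neutral_right) (auto simp: indicator_def dest: other)
      also have "\<dots> = h i"
        using m i \<open>s i < r\<close> by (simp only: sum.insert [OF finite.emptyI] sum.empty empty_iff) simp
      finally show ?thesis .
    qed
  qed
qed

lemma has_bochner_integral_FTC_Ioc: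
  fixes f f' :: "real \<Rightarrow> real"
  assumes "a \<le> b" and f: "\<And>x. (f has_real_derivative f' x) (at x)" and "continuous_on UNIV f'"
  shows "has_bochner_integral lborel (\<lambda>r. indicator {a<..b} r * f' r) (f b - f a)"
proof -
  have Icc: "has_bochner_integral lborel (\<lambda>r. indicator {a..b} r *\<^sub>R f' r) (f b - f a)"
  proof (rule has_bochner_integral_FTC_Icc [OF \<open>a \<le> b\<close>])
    show "(f has_vector_derivative f' x) (at x within {a..b})" for x
      using f [of x] by (simp add: has_real_derivative_iff_has_vector_derivative
          has_vector_derivative_at_within)
    show "continuous_on {a..b} f'"
      using assms(3) by (rule continuous_on_subset) simp
  qed
  have AE: "AE r in lborel. indicator {a..b} r *\<^sub>R f' r = indicator {a<..b} r * f' r"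
    using AE_lborel_singleton [of a] by eventually_elim (auto simp: indicator_def)
  have [measurable]: "f' \<in> borel_measurable borel"
    using assms(3) by (rule borel_measurable_continuous_onI)
  have "has_bochner_integral lborel (\<lambda>r. indicator {a..b} r *\<^sub>R f' r) (f b - f a) \<longleftrightarrow>
      has_bochner_integral lborel (\<lambda>r. indicator {a<..b} r * f' r) (f b - f a)"
    using AE by (intro has_bochner_integral_cong_AE) simp_all
  with Icc show ?thesis
    by simp
qed

text \<open>Summation by parts turns the increments of \<open>f\<close> into integrals of \<open>f'\<close>; the remaining
  integrand evaluates \<open>z\<close> at the next partition point, which converges by right-continuity alone.\<close>

lemma riemann_stieltjes_tendsto:
  fixes f f' z :: "real \<Rightarrow> real" and s :: "nat \<Rightarrow> nat \<Rightarrow> real"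
  assumes f: "\<And>x. (f has_real_derivative f' x) (at x)" and f': "continuous_on UNIV f'"
    and z: "\<And>r. a \<le> r \<Longrightarrow> r \<le> b \<Longrightarrow> \<bar>z r\<bar> \<le> B"
    and z_right: "\<And>r. a \<le> r \<Longrightarrow> continuous (at_right r) z"
    and s: "\<And>k. s k 0 = a" "\<And>k. s k (N k) = b" "\<And>k i. i < N k \<Longrightarrow> s k i \<le> s k (Suc i)"
    and mesh: "\<And>k i. i < N k \<Longrightarrow> s k (Suc i) - s k i \<le> d k" "d \<longlonglongrightarrow> 0"
  shows "(\<lambda>k. \<Sum>i<N k. f (s k i) * (z (s k (Suc i)) - z (s k i))) \<longlonglongrightarrow>
    f b * z b - f a * z a - (LINT r|lborel. indicator {a<..b} r * (f' r * z r))"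
proof -
  have [measurable]: "f' \<in> borel_measurable borel"
    using f' by (rule borel_measurable_continuous_onI)
  have "compact (f' ` {a..b})"
    by (intro compact_continuous_image continuous_on_subset [OF f']) auto
  then have "bounded (f' ` {a..b})"
    by (rule compact_imp_bounded)
  then obtain K where "\<forall>y\<in>f' ` {a..b}. norm y \<le> K"
    unfolding bounded_iff ..
  then have K: "\<bar>f' r\<bar> \<le> K" if "a \<le> r" "r \<le> b" for r
    using that by simp
  \<comment> \<open>\<open>z\<close> is frozen at the right endpoint of each interval while
    \<open>f'\<close> stays exact, so the integral of \<open>g k\<close> is exactly the sum left
    over by \<open>sum_by_parts\<close>.\<close>
  define g where "g k r = (\<Sum>i<N k. indicator {s k i<..s k (Suc i)} r * (f' r * z (s k (Suc i))))" for k r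
  have in_ab: "a \<le> s k i" "s k i \<le> b" if "i \<le> N k" for k i
    using partition_mono [of "N k" "s k" 0 i] partition_mono [of "N k" "s k" i "N k"] s that by auto
  have g_out: "g k r = 0" if "r \<notin> {a<..b}" for k r
    unfolding g_def
  proof (intro sum.neutral ballI)
    fix i assume "i \<in> {..<N k}"
    then have "a \<le> s k i" "s k (Suc i) \<le> b"
      by (auto intro: in_ab)
    with that show "indicator {s k i<..s k (Suc i)} r * (f' r * z (s k (Suc i))) = 0"
      by (auto simp: indicator_def)
  qed
  have g_in: "\<exists>n. r \<le> n \<and> n \<le> b \<and> n \<le> r + d k \<and> g k r = f' r * z n" if r: "r \<in> {a<..b}" for k r
  proof -
    obtain i where i: "i < N k" "s k i < r" "r \<le> s k (Suc i)"
      "\<And>h :: nat \<Rightarrow> real. (\<Sum>j<N k. indicator {s k j<..s k (Suc j)} r * h j) = h i"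
      using partition_interval [of "N k" "s k" r] s r by auto
    have "s k (Suc i) \<le> b"
      using i by (auto intro: in_ab)
    then show ?thesis
      using i mesh(1) [of i k] unfolding g_def
      by (intro exI [of _ "s k (Suc i)"]) auto
  qed
  have g_tendsto: "(\<lambda>k. g k r) \<longlonglongrightarrow> indicator {a<..b} r * (f' r * z r)" for r
  proof (cases "r \<in> {a<..b}")
    case True
    have "\<forall>k. \<exists>n. r \<le> n \<and> n \<le> b \<and> n \<le> r + d k \<and> g k r = f' r * z n"
      using g_in [OF True] by blast
    from choice [OF this] obtain n
      where n: "\<And>k. r \<le> n k" "\<And>k. n k \<le> r + d k" "\<And>k. g k r = f' r * z (n k)"
      by blast
    have "n \<longlonglongrightarrow> r"
      by (rule tendsto_sandwich [where f = "\<lambda>_. r" and h = "\<lambda>k. r + d k"])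
        (use n tendsto_add [OF tendsto_const mesh(2), of r] in auto)
    \<comment> \<open>The points \<open>n k\<close> may coincide with \<open>r\<close>, so
      right-continuity is restated on the closed half-line.\<close>
    moreover have "continuous (at r within {r..}) z"
      using z_right [of r] True by (simp add: continuous_within at_within_Ici_at_right)
    ultimately have "(\<lambda>k. z (n k)) \<longlonglongrightarrow> z r"
      using n(1) by (intro continuous_within_tendsto_compose [of r "{r..}" z n]) auto
    then show ?thesis
      using True by (simp add: n(3) tendsto_mult_left)
  next
    case False
    then show ?thesis
      by (simp add: g_out [OF False] indicator_simps(2) [OF False] del: greaterThanAtMost_iff)
  qed
  have finite_measure_Ioc: "emeasure lborel {a<..b} < \<infinity>"
    by (cases "a \<le> b") auto
  have "(\<lambda>k. LINT r|lborel. g k r) \<longlonglongrightarrow> (LINT r|lborel. indicator {a<..b} r * (f' r * z r))"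
  proof (rule integral_dominated_convergence [where w = "\<lambda>r. indicator {a<..b} r * (K * B)"])
    show [measurable]: "g k \<in> borel_measurable lborel" for k
      unfolding g_def [abs_def] by measurable
    show "(\<lambda>r. indicator {a<..b} r * (f' r * z r)) \<in> borel_measurable lborel"
      by (rule borel_measurable_LIMSEQ_real [OF g_tendsto]) simp
    show "integrable lborel (\<lambda>r. indicator {a<..b} r * (K * B))"
      using finite_measure_Ioc by (intro integrable_mult_left integrable_real_indicator) auto
    show "AE r in lborel. norm (g k r) \<le> indicator {a<..b} r * (K * B)" for k
    proof (rule AE_I2)
      fix r
      show "norm (g k r) \<le> indicator {a<..b} r * (K * B)"
      proof (cases "r \<in> {a<..b}")
        case True
        with g_in [OF True, of k] obtain n where n: "r \<le> n" "n \<le> b" "g k r = f' r * z n" by auto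
        show ?thesis
          using True n K [of r] z [of n] by (auto simp: abs_mult intro: mult_mono)
      qed (simp add: g_out)
    qed
  qed (intro AE_I2 g_tendsto)
  moreover have "(LINT r|lborel. g k r) = (\<Sum>i<N k. (f (s k (Suc i)) - f (s k i)) * z (s k (Suc i)))" for k
  proof -
    have "has_bochner_integral lborel
        (\<lambda>r. \<Sum>i<N k. (indicator {s k i<..s k (Suc i)} r * f' r) * z (s k (Suc i)))
        (\<Sum>i<N k. (f (s k (Suc i)) - f (s k i)) * z (s k (Suc i)))"
      using f f' s(3) by (intro has_bochner_integral_sum has_bochner_integral_mult_left
          has_bochner_integral_FTC_Ioc) auto
    then show ?thesis
      by (simp add: g_def [abs_def] has_bochner_integral_integral_eq mult.assoc)
  qed
  ultimately have "(\<lambda>k. \<Sum>i<N k. (f (s k (Suc i)) - f (s k i)) * z (s k (Suc i))) \<longlonglongrightarrow>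
      (LINT r|lborel. indicator {a<..b} r * (f' r * z r))"
    by simp
  then have lim: "(\<lambda>k. f b * z b - f a * z a - (\<Sum>i<N k. (f (s k (Suc i)) - f (s k i)) * z (s k (Suc i))))
      \<longlonglongrightarrow> f b * z b - f a * z a - (LINT r|lborel. indicator {a<..b} r * (f' r * z r))"
    by (intro tendsto_diff tendsto_const)
  have eq: "(\<Sum>i<N k. f (s k i) * (z (s k (Suc i)) - z (s k i))) =
      f b * z b - f a * z a - (\<Sum>i<N k. (f (s k (Suc i)) - f (s k i)) * z (s k (Suc i)))" for k
    using sum_by_parts [of f "s k" z "N k"] unfolding s(1,2) .
  show ?thesis
    unfolding eq by (rule lim)
qed


text \<open>The right limit, the left limit and the value at a point bound the function near that
  point. Compactness of \<open>{a..b}\<close> leaves finitely many such neighbourhoods.\<close>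

lemma cadlag_bounded:
  fixes z :: "real \<Rightarrow> 'a :: real_normed_vector"
  assumes right: "\<And>r. a \<le> r \<Longrightarrow> continuous (at_right r) z"
    and left: "\<And>r. a < r \<Longrightarrow> \<exists>l. (z \<longlongrightarrow> l) (at_left r)"
  shows "\<exists>B. \<forall>r. a \<le> r \<and> r \<le> b \<longrightarrow> norm (z r) \<le> B"
proof -
  have loc: "\<exists>U. open U \<and> r \<in> U \<and> bounded (z ` (U \<inter> {a..b}))" if r: "r \<in> {a..b}" for r
  proof -
    have bdd: "\<exists>C. \<forall>\<^sub>F x in F. norm (z x) \<le> C" if "(z \<longlongrightarrow> l) F" for l F
    proof -
      have "\<forall>\<^sub>F x in F. norm (z x) < norm l + 1"
        by (rule order_tendstoD(2) [OF tendsto_norm [OF that]]) simp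
      then have "\<forall>\<^sub>F x in F. norm (z x) \<le> norm l + 1"
        by eventually_elim simp
      then show ?thesis ..
    qed
    obtain C1 where C1: "\<forall>\<^sub>F x in at_right r. norm (z x) \<le> C1"
      using bdd [of "z r"] right [of r] r by (auto simp: continuous_within)
    obtain C2 where C2: "\<forall>\<^sub>F x in at_left r. a \<le> x \<longrightarrow> norm (z x) \<le> C2"
    proof (cases "a < r")
      case True
      then obtain l where "(z \<longlongrightarrow> l) (at_left r)"
        using left by blast
      from bdd [OF this] obtain C where "\<forall>\<^sub>F x in at_left r. norm (z x) \<le> C" ..
      then have "\<forall>\<^sub>F x in at_left r. a \<le> x \<longrightarrow> norm (z x) \<le> C"
        by eventually_elim simp
      then show ?thesis by (rule that)
    next
      \<comment> \<open>Here \<open>r = a\<close>, and no point to the left of \<open>r\<close>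
        satisfies \<open>a \<le> x\<close>, so the bound is vacuous.\<close>
      case False
      have "\<forall>\<^sub>F x in at_left r. a \<le> x \<longrightarrow> norm (z x) \<le> 0"
        using False by (auto simp: eventually_at_filter)
      then show ?thesis by (rule that)
    qed
    have "\<forall>\<^sub>F x in at_left r. a \<le> x \<longrightarrow> norm (z x) \<le> max C1 C2"
      using C2 by eventually_elim (simp add: le_max_iff_disj)
    moreover have "\<forall>\<^sub>F x in at_right r. a \<le> x \<longrightarrow> norm (z x) \<le> max C1 C2"
      using C1 by eventually_elim (simp add: le_max_iff_disj)
    ultimately have "\<forall>\<^sub>F x in at r. a \<le> x \<longrightarrow> norm (z x) \<le> max C1 C2"
      by (simp only: eventually_at_split)
    then have "\<forall>\<^sub>F x in nhds r. x \<noteq> r \<longrightarrow> a \<le> x \<longrightarrow> norm (z x) \<le> max C1 C2"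
      by (simp add: eventually_at_filter)
    then have "\<forall>\<^sub>F x in nhds r. a \<le> x \<longrightarrow> norm (z x) \<le> max (max C1 C2) (norm (z r))"
      by eventually_elim auto
    then obtain U where "open U" "r \<in> U" "\<forall>x\<in>U. a \<le> x \<longrightarrow> norm (z x) \<le> max (max C1 C2) (norm (z r))"
      unfolding eventually_nhds by blast
    then show ?thesis
      by (intro exI [of _ U] conjI boundedI [of _ "max (max C1 C2) (norm (z r))"]) auto
  qed
  have "\<forall>r\<in>{a..b}. \<exists>U. open U \<and> r \<in> U \<and> bounded (z ` (U \<inter> {a..b}))"
    using loc by blast
  from bchoice [OF this] obtain U
    where U: "\<forall>r\<in>{a..b}. open (U r) \<and> r \<in> U r \<and> bounded (z ` (U r \<inter> {a..b}))" ..
  obtain T where T: "T \<subseteq> {a..b}" "finite T" "{a..b} \<subseteq> (\<Union>r\<in>T. U r)"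
    by (rule compactE_image [OF compact_Icc [of a b], of "{a..b}" U]) (use U in auto)
  have "bounded (\<Union>r\<in>T. z ` (U r \<inter> {a..b}))"
    using T U by (intro bounded_UN) auto
  moreover have "z ` {a..b} \<subseteq> (\<Union>r\<in>T. z ` (U r \<inter> {a..b}))"
    using T by blast
  ultimately have "bounded (z ` {a..b})"
    by (rule bounded_subset)
  then obtain B where "\<forall>y\<in>z ` {a..b}. norm y \<le> B"
    unfolding bounded_iff ..
  then show ?thesis
    by (intro exI [of _ B]) simp
qed

section \<open>Supports and characteristic functions\<close>

lemma borel_measurable_vec_nth [measurable (raw)]:
  fixes f :: "'a \<Rightarrow> real ^ 'n"
  assumes "f \<in> borel_measurable M"
  shows "(\<lambda>x. f x $ i) \<in> borel_measurable M"
  using assms by (rule borel_measurable_continuous_on [rotated]) (intro continuous_intros)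

lemma (in prob_space) integrable_iexp:
  assumes "f \<in> borel_measurable M"
  shows "integrable M (\<lambda>x. iexp (f x))"
  using assms by (intro integrable_const_bound [of _ 1]) auto

section \<open>Gaussian averages determined by the characteristic function\<close>

abbreviation normal_product :: "('n::finite \<Rightarrow> real) measure" where
  "normal_product \<equiv> PiM UNIV (\<lambda>_. std_normal_distribution)"

lemma prob_space_normal_product: "prob_space normal_product"
  by (intro prob_space_PiM prob_space_normal_density) simp

text \<open>Independence of the coordinates factors the integral. Read from right to left, the
  identity writes a Gaussian function of \<open>y\<close> as an average of characters. The Gaussian
  vector is carried by a product measure on functions, and \<open>\<chi> i. f i\<close> turns these
  into vectors.\<close>

lemma char_normal_product:
  fixes y :: "real ^ 'n"
  shows "(CLINT f|normal_product. iexp (\<sigma> * ((\<chi> i. f i) \<bullet> y))) = exp (- (\<sigma>\<^sup>2 * (norm y)\<^sup>2 / 2))"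
proof -
  interpret N: prob_space std_normal_distribution
    by (rule prob_space_normal_density) simp
  interpret product_sigma_finite "\<lambda>_::'n. std_normal_distribution"
    by unfold_locales
  have "(CLINT f|normal_product. iexp (\<sigma> * ((\<chi> i. f i) \<bullet> y))) =
      (CLINT f|normal_product. (\<Prod>i\<in>UNIV. iexp (\<sigma> * y $ i * f i)))"
    by (simp add: inner_vec_def sum_distrib_left exp_sum mult_ac)
  also have "\<dots> = (\<Prod>i\<in>UNIV. CLINT x|std_normal_distribution. iexp (\<sigma> * y $ i * x))"
    by (rule product_integral_prod) (use N.integrable_iexp in \<open>auto simp del: of_real_mult\<close>)
  also have "\<dots> = (\<Prod>i\<in>UNIV. complex_of_real (exp (- ((\<sigma> * y $ i)\<^sup>2) / 2)))"
    using fun_cong [OF char_std_normal_distribution] by (simp only: char_def)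
  also have "\<dots> = complex_of_real (exp (\<Sum>i\<in>UNIV. - ((\<sigma> * y $ i)\<^sup>2) / 2))"
    by (simp add: exp_sum)
  also have "(\<Sum>i\<in>UNIV. - ((\<sigma> * y $ i)\<^sup>2) / 2) = - (\<sigma>\<^sup>2 * (norm y)\<^sup>2 / 2)"
  proof -
    have "(norm y)\<^sup>2 = (\<Sum>i\<in>UNIV. (y $ i)\<^sup>2)"
      by (simp only: power2_norm_eq_inner inner_vec_def) (simp add: power2_eq_square)
    then show ?thesis
      by (simp add: sum_distrib_left sum_divide_distrib sum_negf power_mult_distrib)
  qed
  finally show ?thesis .
qed

definition vec_char :: "(real ^ 'n) measure \<Rightarrow> real ^ 'n \<Rightarrow> complex" where
  "vec_char P u = (CLINT x|P. iexp (x \<bullet> u))"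

text \<open>A Parseval identity: the Gaussian is expanded into characters by
  \<open>char_normal_product\<close> and the integrals are exchanged. The right-hand side sees
  \<open>P\<close> only through \<open>vec_char P\<close>.\<close>

lemma gaussian_smoothing:
  fixes P :: "(real ^ 'n) measure"
  assumes "prob_space P" and [measurable_cong]: "sets P = sets borel"
  shows "complex_of_real (LINT x|P. exp (- (\<sigma>\<^sup>2 * (norm (x - y))\<^sup>2 / 2))) =
    (CLINT f|normal_product. iexp (- (\<sigma> * ((\<chi> i. f i) \<bullet> y))) * vec_char P (\<sigma> *\<^sub>R (\<chi> i. f i)))"
proof -
  interpret P: prob_space P by fact
  interpret N: prob_space "normal_product :: ('n \<Rightarrow> real) measure"
    by (rule prob_space_normal_product)
  interpret PN: pair_prob_space P "normal_product :: ('n \<Rightarrow> real) measure" ..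
  have "complex_of_real (LINT x|P. exp (- (\<sigma>\<^sup>2 * (norm (x - y))\<^sup>2 / 2))) =
      (CLINT x|P. CLINT f|normal_product. iexp (\<sigma> * ((\<chi> i. f i) \<bullet> (x - y))))"
    by (simp only: char_normal_product integral_complex_of_real)
  also have "\<dots> = (CLINT f|normal_product. CLINT x|P. iexp (\<sigma> * ((\<chi> i. f i) \<bullet> (x - y))))"
  proof (rule PN.Fubini_integral [symmetric])
    have "(\<lambda>(x, f). \<sigma> * (\<Sum>i\<in>UNIV. f i * (x - y) $ i))
        \<in> borel_measurable (P \<Otimes>\<^sub>M (normal_product :: ('n \<Rightarrow> real) measure))"
      by measurable
    from prob_space.integrable_iexp [OF prob_space_pair this]
    show "complex_integrable (P \<Otimes>\<^sub>M (normal_product :: ('n \<Rightarrow> real) measure))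
        (\<lambda>(x, f). iexp (\<sigma> * ((\<chi> i. f i) \<bullet> (x - y))))"
      by (simp add: case_prod_unfold inner_vec_def P.prob_space_axioms N.prob_space_axioms)
  qed
  also have "\<dots> = (CLINT f|normal_product. iexp (- (\<sigma> * ((\<chi> i. f i) \<bullet> y))) *
      vec_char P (\<sigma> *\<^sub>R (\<chi> i. f i)))"
  proof (rule Bochner_Integration.integral_cong [OF refl])
    fix f :: "'n \<Rightarrow> real"
    have "(CLINT x|P. iexp (\<sigma> * ((\<chi> i. f i) \<bullet> (x - y)))) =
        (CLINT x|P. iexp (- (\<sigma> * ((\<chi> i. f i) \<bullet> y))) * iexp (x \<bullet> (\<sigma> *\<^sub>R (\<chi> i. f i))))"
      by (simp add: exp_add [symmetric] inner_diff_right inner_commute algebra_simps)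
    then show "(CLINT x|P. iexp (\<sigma> * ((\<chi> i. f i) \<bullet> (x - y)))) =
        iexp (- (\<sigma> * ((\<chi> i. f i) \<bullet> y))) * vec_char P (\<sigma> *\<^sub>R (\<chi> i. f i))"
      by (simp add: vec_char_def)
  qed
  finally show ?thesis .
qed

text \<open>The Gaussian averages of scale \<open>1 / \<sigma>\<close> around \<open>y\<close> are determined by the characteristic
  function, and their exponential decay rate as \<open>\<sigma> \<rightarrow> \<infinity>\<close> detects the distance of \<open>y\<close> to the
  support. This needs no uniqueness theorem for characteristic functions on \<open>\<real>\<^sup>n\<close>.\<close>

lemma measure_support_mono_char:
  fixes P Q :: "(real ^ 'n) measure"
  assumes P: "prob_space P" "sets P = sets borel" and Q: "prob_space Q" "sets Q = sets borel"
    and char_eq: "vec_char P = vec_char Q"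
  shows "measure_support P \<subseteq> measure_support Q"
proof
  fix y assume y: "y \<in> measure_support P"
  interpret P: prob_space P by fact
  interpret Q: prob_space Q by fact
  note [measurable_cong] = P(2) Q(2)
  have smooth: "(LINT x|P. exp (- (\<sigma>\<^sup>2 * (norm (x - y))\<^sup>2 / 2))) =
      (LINT x|Q. exp (- (\<sigma>\<^sup>2 * (norm (x - y))\<^sup>2 / 2)))" for \<sigma>
  proof -
    have "complex_of_real (LINT x|P. exp (- (\<sigma>\<^sup>2 * (norm (x - y))\<^sup>2 / 2))) =
        complex_of_real (LINT x|Q. exp (- (\<sigma>\<^sup>2 * (norm (x - y))\<^sup>2 / 2)))"
      by (simp only: gaussian_smoothing [OF P] gaussian_smoothing [OF Q] char_eq)
    then show ?thesis
      by (simp only: of_real_eq_iff)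
  qed
  have integrable: "integrable P (\<lambda>x. exp (- (\<sigma>\<^sup>2 * (norm (x - y))\<^sup>2 / 2)))"
    "integrable Q (\<lambda>x. exp (- (\<sigma>\<^sup>2 * (norm (x - y))\<^sup>2 / 2)))" for \<sigma>
    by (intro P.integrable_const_bound [of _ 1] Q.integrable_const_bound [of _ 1]; simp)+
  show "y \<in> measure_support Q"
  proof (rule ccontr)
    assume "y \<notin> measure_support Q"
    then obtain U where U: "open U" "y \<in> U" "emeasure Q U = 0"
      by (auto simp: measure_support_def)
    then obtain r where r: "r > 0" "ball y r \<subseteq> U"
      using open_contains_ball by blast
    have "U \<in> sets Q"
      using U Q by simp
    then have AE: "AE x in Q. x \<notin> U"
      using U by (intro AE_not_in) (auto simp: null_sets_def)
    let ?b = "ball y (r / 2)"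
    \<comment> \<open>On \<open>?b\<close> the Gaussian is at least
      \<open>exp (- (\<sigma>\<^sup>2 * r\<^sup>2 / 8))\<close>, while \<open>Q\<close> lives
      outside \<open>ball y r\<close>, where it is at most
      \<open>exp (- (\<sigma>\<^sup>2 * r\<^sup>2 / 2))\<close>. The factor 3/8 is 1/2 -
      1/8.\<close>
    have bound: "P.prob ?b \<le> exp (- (\<sigma>\<^sup>2 * (3 * r\<^sup>2 / 8)))" for \<sigma>
    proof -
      have "exp (- (\<sigma>\<^sup>2 * (r / 2)\<^sup>2 / 2)) * P.prob ?b =
          (LINT x|P. exp (- (\<sigma>\<^sup>2 * (r / 2)\<^sup>2 / 2)) * indicator ?b x)"
        using P(2) by simp
      also have "\<dots> \<le> (LINT x|P. exp (- (\<sigma>\<^sup>2 * (norm (x - y))\<^sup>2 / 2)))"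
      proof (rule integral_mono [OF _ integrable(1)])
        show "integrable P (\<lambda>x. exp (- (\<sigma>\<^sup>2 * (r / 2)\<^sup>2 / 2)) * indicator ?b x)"
          using P(2) by (intro integrable_mult_right integrable_real_indicator) (auto simp: P.emeasure_eq_measure)
        fix x
        show "exp (- (\<sigma>\<^sup>2 * (r / 2)\<^sup>2 / 2)) * indicator ?b x \<le> exp (- (\<sigma>\<^sup>2 * (norm (x - y))\<^sup>2 / 2))"
        proof (cases "x \<in> ?b")
          case True
          then have "norm (x - y) \<le> r / 2"
            by (simp add: dist_norm norm_minus_commute)
          then have "\<sigma>\<^sup>2 * (norm (x - y))\<^sup>2 \<le> \<sigma>\<^sup>2 * (r / 2)\<^sup>2"
            by (intro mult_left_mono power_mono) auto
          with True show ?thesis by simp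
        qed simp
      qed
      also have "\<dots> = (LINT x|Q. exp (- (\<sigma>\<^sup>2 * (norm (x - y))\<^sup>2 / 2)))"
        by (rule smooth)
      also have "\<dots> \<le> (LINT x|Q. exp (- (\<sigma>\<^sup>2 * r\<^sup>2 / 2)))"
      proof (rule integral_mono_AE [OF integrable(2)])
        show "AE x in Q. exp (- (\<sigma>\<^sup>2 * (norm (x - y))\<^sup>2 / 2)) \<le> exp (- (\<sigma>\<^sup>2 * r\<^sup>2 / 2))"
          using AE
        proof eventually_elim
          case (elim x)
          then have "x \<notin> ball y r"
            using r by auto
          then have "r \<le> norm (x - y)"
            by (simp add: dist_norm norm_minus_commute)
          then have "\<sigma>\<^sup>2 * r\<^sup>2 \<le> \<sigma>\<^sup>2 * (norm (x - y))\<^sup>2"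
            using r by (intro mult_left_mono power_mono) auto
          then show ?case by simp
        qed
      qed simp
      also have "\<dots> = exp (- (\<sigma>\<^sup>2 * r\<^sup>2 / 2))"
        by (simp add: Q.prob_space)
      finally have "P.prob ?b \<le> exp (- (\<sigma>\<^sup>2 * r\<^sup>2 / 2)) / exp (- (\<sigma>\<^sup>2 * (r / 2)\<^sup>2 / 2))"
        by (simp add: field_simps)
      also have "\<dots> = exp (- (\<sigma>\<^sup>2 * (3 * r\<^sup>2 / 8)))"
        by (simp add: exp_diff [symmetric] power_divide)
      finally show ?thesis .
    qed
    have "filterlim (\<lambda>\<sigma>::real. \<sigma>\<^sup>2 * (3 * r\<^sup>2 / 8)) at_top at_top"
      using r by (intro filterlim_at_top_mult_tendsto_pos [OF tendsto_const]
          filterlim_pow_at_top filterlim_ident) auto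
    then have "((\<lambda>\<sigma>::real. exp (- (\<sigma>\<^sup>2 * (3 * r\<^sup>2 / 8)))) \<longlongrightarrow> 0) at_top"
      by (intro filterlim_compose [OF exp_at_bot] filterlim_compose [OF filterlim_uminus_at_bot_at_top])
    then have "P.prob ?b \<le> 0"
      by (rule tendsto_lowerbound) (use bound in auto)
    moreover have "0 < emeasure P ?b"
      using y r by (auto simp: measure_support_def)
    ultimately show False
      by (simp add: P.emeasure_eq_measure)
  qed
qed

lemma measure_support_eq_char:
  fixes P Q :: "(real ^ 'n) measure"
  assumes "prob_space P" "sets P = sets borel" "prob_space Q" "sets Q = sets borel"
    and "vec_char P = vec_char Q"
  shows "measure_support P = measure_support Q"
  using assms by (intro equalityI measure_support_mono_char) simp_all

section \<open>Topological facts about supports\<close>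

lemma closed_measure_support: "closed (measure_support P)"
  unfolding closed_def
proof (subst open_subopen, intro ballI)
  fix x assume "x \<in> - measure_support P"
  then obtain U where "open U" "x \<in> U" "\<not> 0 < emeasure P U"
    by (auto simp: measure_support_def)
  then show "\<exists>U. open U \<and> x \<in> U \<and> U \<subseteq> - measure_support P"
    by (intro exI [of _ U]) (auto simp: measure_support_def)
qed

text \<open>A countable basis covers the complement of the support by countably many open null
  sets.\<close>

lemma AE_in_measure_support:
  fixes P :: "'a::second_countable_topology measure"
  assumes "sets P = sets borel"
  shows "AE x in P. x \<in> measure_support P"
proof -
  obtain B :: "'a set set" where B: "countable B" "topological_basis B"
    using ex_countable_basis by blast
  let ?N = "\<Union>U\<in>{U \<in> B. emeasure P U = 0}. U"
  have "?N \<in> null_sets P"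
    using B assms by (intro null_sets_UN') (auto simp: null_sets_def topological_basis_open)
  moreover have "- measure_support P \<subseteq> ?N"
  proof
    fix x assume "x \<in> - measure_support P"
    then obtain U where U: "open U" "x \<in> U" "emeasure P U = 0"
      by (auto simp: measure_support_def)
    then obtain V where V: "V \<in> B" "x \<in> V" "V \<subseteq> U"
      using topological_basisE [OF B(2)] by metis
    then have "emeasure P V \<le> emeasure P U"
      using U assms by (intro emeasure_mono) auto
    with U V show "x \<in> ?N" by auto
  qed
  ultimately show ?thesis
    by (intro AE_I' [of ?N]) auto
qed

section \<open>The support of a symmetric stable law\<close>

lemma one_minus_cos_le: "1 - cos z \<le> z\<^sup>2 / 2" for z :: real
proof -
  have "(sin (z / 2))\<^sup>2 \<le> (z / 2)\<^sup>2"
    using abs_sin_x_le_abs_x [of "z / 2"] by (simp only: abs_le_square_iff)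
  then show ?thesis
    using cos_double_sin [of "z / 2"] by (simp add: power_divide)
qed

lemma subspace_orthogonal_vector:
  fixes T :: "'a::euclidean_space set"
  assumes "subspace T" "T \<noteq> UNIV"
  obtains v where "v \<noteq> 0" "\<And>y. y \<in> T \<Longrightarrow> y \<bullet> v = 0"
proof -
  have "dim T < DIM('a)"
    using assms dim_eq_full [of T] span_eq_iff [of T] dim_subset_UNIV [of T] by (metis le_neq_implies_less)
  then obtain v where "v \<noteq> 0" "\<And>y. y \<in> span T \<Longrightarrow> orthogonal v y"
    using orthogonal_to_subspace_exists by blast
  then show thesis
    by (intro that [of v]) (auto simp: orthogonal_def inner_commute span_base)
qed

text \<open>Stability is expressed by functional relations and a bound for the characteristic
  function \<open>p\<close> itself rather than for an exponent. Such conditions pass to pointwise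
  limits, which is how the locale is instantiated.\<close>

locale symmetric_stable_law = prob_space P for P :: "(real ^ 'n) measure" +
  fixes \<alpha> c :: real and p :: "real ^ 'n \<Rightarrow> real"
  assumes sets_P [simp, measurable_cong]: "sets P = sets borel"
    and \<alpha>: "0 < \<alpha>" "\<alpha> < 2" and c: "0 < c"
    and char: "vec_char P u = complex_of_real (p u)"
    and p_minus: "p (- u) = p u"
    and p_stable: "\<lbrakk>0 < a; 0 < b; a powr \<alpha> + b powr \<alpha> = 1\<rbrakk> \<Longrightarrow> p (a *\<^sub>R u) * p (b *\<^sub>R u) = p u"
    and p_le: "p u \<le> exp (- c * norm u powr \<alpha>)"
begin

abbreviation supp :: "(real ^ 'n) set" where
  "supp \<equiv> measure_support P"

lemma space_P [simp]: "space P = UNIV"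
  using sets_eq_imp_space_eq [OF sets_P] by simp

lemma prob_UNIV [simp]: "prob UNIV = 1"
  using prob_space by simp

section \<open>Algebraic structure of the support\<close>

lemma supp_minus:
  assumes "x \<in> supp"
  shows "- x \<in> supp"
proof -
  let ?Q = "distr P borel uminus"
  have "vec_char ?Q u = vec_char P u" for u
  proof -
    have "vec_char ?Q u = vec_char P (- u)"
      unfolding vec_char_def by (subst integral_distr) auto
    then show ?thesis
      by (simp add: char p_minus)
  qed
  then have "measure_support ?Q = supp"
    by (intro measure_support_eq_char prob_space_distr prob_space_axioms) auto
  moreover have "- x \<in> measure_support ?Q"
    unfolding measure_support_def
  proof (intro CollectI allI impI)
    fix U :: "(real ^ 'n) set" assume U: "open U \<and> - x \<in> U"
    have "emeasure ?Q U = emeasure P (uminus -` U)"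
      using U by (subst emeasure_distr) auto
    moreover have "open (uminus -` U)" "x \<in> uminus -` U"
      using U by (auto intro!: open_vimage continuous_intros)
    ultimately show "0 < emeasure ?Q U"
      using assms by (auto simp: measure_support_def)
  qed
  ultimately show ?thesis by simp
qed

text \<open>For independent \<open>X\<close> and \<open>Y\<close> with law \<open>P\<close>, the
  vector \<open>a X + b Y\<close> has characteristic function \<open>p (a u) p (b u) = p u\<close>,
  hence the same support as \<open>P\<close>; and its support contains
  \<open>a x + b y\<close>.\<close>

lemma supp_combination:
  assumes x: "x \<in> supp" and y: "y \<in> supp"
    and ab: "0 < a" "0 < b" "a powr \<alpha> + b powr \<alpha> = 1"
  shows "a *\<^sub>R x + b *\<^sub>R y \<in> supp"
proof -
  interpret PP: pair_prob_space P P ..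
  let ?f = "\<lambda>(x, y). a *\<^sub>R x + b *\<^sub>R y"
  let ?Q = "distr (P \<Otimes>\<^sub>M P) borel ?f"
  have [measurable]: "?f \<in> borel_measurable (P \<Otimes>\<^sub>M P)"
    by measurable
  have "vec_char ?Q u = vec_char P u" for u
  proof -
    have "vec_char ?Q u = (CLINT z|P \<Otimes>\<^sub>M P. (case z of (x, y) \<Rightarrow>
        iexp (x \<bullet> (a *\<^sub>R u)) * iexp (y \<bullet> (b *\<^sub>R u))))"
      unfolding vec_char_def
      by (subst integral_distr)
        (auto simp: case_prod_unfold inner_add_left exp_add [symmetric] algebra_simps)
    also have "\<dots> = (CLINT x|P. CLINT y|P. iexp (x \<bullet> (a *\<^sub>R u)) * iexp (y \<bullet> (b *\<^sub>R u)))"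
    proof (rule PP.integral_fst [symmetric])
      have "(\<lambda>(x, y). x \<bullet> (a *\<^sub>R u) + y \<bullet> (b *\<^sub>R u)) \<in> borel_measurable (P \<Otimes>\<^sub>M P)"
        by measurable
      from prob_space.integrable_iexp [OF PP.prob_space_axioms this]
      show "complex_integrable (P \<Otimes>\<^sub>M P)
          (\<lambda>(x, y). iexp (x \<bullet> (a *\<^sub>R u)) * iexp (y \<bullet> (b *\<^sub>R u)))"
        by (simp add: case_prod_unfold exp_add [symmetric] algebra_simps)
    qed
    also have "\<dots> = vec_char P (a *\<^sub>R u) * vec_char P (b *\<^sub>R u)"
      by (simp add: vec_char_def)
    also have "\<dots> = vec_char P u"
      using p_stable [OF ab] by (simp add: char flip: of_real_mult)
    finally show ?thesis .
  qed
  then have "measure_support ?Q = supp"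
    by (intro measure_support_eq_char prob_space_axioms PP.prob_space_distr) auto
  moreover have "a *\<^sub>R x + b *\<^sub>R y \<in> measure_support ?Q"
    unfolding measure_support_def
  proof (intro CollectI allI impI)
    fix U :: "(real ^ 'n) set" assume U: "open U \<and> a *\<^sub>R x + b *\<^sub>R y \<in> U"
    have "open (?f -` U)"
      unfolding case_prod_unfold using U by (intro open_vimage continuous_intros) auto
    moreover have "(x, y) \<in> ?f -` U"
      using U by simp
    ultimately obtain V W where VW: "open V" "open W" "(x, y) \<in> V \<times> W" "V \<times> W \<subseteq> ?f -` U"
      by (rule open_prod_elim)
    \<comment> \<open>A rectangle around \<open>(x, y)\<close> inside the preimage has positive
      product mass, since both of its sides are neighbourhoods of points of the support.\<close>
    have "0 < emeasure P V * emeasure P W"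
      using VW x y by (auto simp: measure_support_def ennreal_zero_less_mult_iff)
    also have "\<dots> = emeasure (P \<Otimes>\<^sub>M P) (V \<times> W)"
      using VW by (intro emeasure_pair_measure_Times [symmetric]) auto
    also have "\<dots> \<le> emeasure (P \<Otimes>\<^sub>M P) (?f -` U \<inter> space (P \<Otimes>\<^sub>M P))"
    proof (rule emeasure_mono)
      show "V \<times> W \<subseteq> ?f -` U \<inter> space (P \<Otimes>\<^sub>M P)"
        using VW by (simp add: space_pair_measure)
      show "?f -` U \<inter> space (P \<Otimes>\<^sub>M P) \<in> sets (P \<Otimes>\<^sub>M P)"
        using U by (intro measurable_sets [of ?f _ borel]) simp_all
    qed
    also have "\<dots> = emeasure ?Q U"
      using U by (subst emeasure_distr) auto
    finally show "0 < emeasure ?Q U" .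
  qed
  ultimately show ?thesis by simp
qed

lemma zero_in_supp: "0 \<in> supp"
proof -
  have "AE x in P. x \<in> supp"
    by (rule AE_in_measure_support) simp
  \<comment> \<open>A probability measure is not concentrated on the empty set, so the support has a
    point.\<close>
  then have "\<not> (AE x in P. x \<notin> supp)"
    using AE_contr by blast
  then obtain x where x: "x \<in> supp"
    by auto
  \<comment> \<open>The weight with \<open>?a powr \<alpha> = 1 / 2\<close>: used twice, it is
    admissible in \<open>supp_combination\<close> and cancels \<open>x\<close> against
    \<open>- x\<close>.\<close>
  let ?a = "2 powr (- 1 / \<alpha>) :: real"
  have "?a powr \<alpha> = 2 powr (- 1)"
    using \<alpha> unfolding powr_powr by simp
  then have "?a powr \<alpha> = 1 / 2"
    by (simp add: powr_minus_divide)
  then have "?a *\<^sub>R x + ?a *\<^sub>R (- x) \<in> supp"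
    by (intro supp_combination x supp_minus) auto
  then show ?thesis by simp
qed

text \<open>For a factor in (0, 1), combining \<open>x\<close> with the support point
  \<open>0\<close>, which takes the complementary weight, leaves a contraction of \<open>x\<close>.
  Negative factors follow by symmetry.\<close>

lemma supp_scaleR_le_1:
  assumes "x \<in> supp" "\<bar>r\<bar> \<le> 1"
  shows "r *\<^sub>R x \<in> supp"
proof -
  have *: "s *\<^sub>R x \<in> supp" if "0 < s" "s < 1" for s
  proof -
    have "s powr \<alpha> < 1"
      using that \<alpha> powr_less_mono2 [of \<alpha> s 1] by simp
    then have "((1 - s powr \<alpha>) powr (1 / \<alpha>)) powr \<alpha> = 1 - s powr \<alpha>"
      using \<alpha> by (simp add: powr_powr)
    then have "s *\<^sub>R x + ((1 - s powr \<alpha>) powr (1 / \<alpha>)) *\<^sub>R 0 \<in> supp"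
      using that \<open>s powr \<alpha> < 1\<close> by (intro supp_combination assms(1) zero_in_supp) auto
    then show ?thesis by simp
  qed
  consider "r = 0" | "r = 1" | "r = - 1" | "0 < r" "r < 1" | "0 < - r" "- r < 1"
    using assms(2) by argo
  then show ?thesis
    using supp_minus [OF * [of "- r"]] * [of r] zero_in_supp assms(1) supp_minus
    by cases auto
qed

text \<open>The analogue of the lineality space of a convex set, for a support known so far to be
  closed, symmetric and star-shaped.\<close>

definition lines :: "(real ^ 'n) set" where
  "lines = {x. \<forall>r. r *\<^sub>R x \<in> supp}"

lemma linesD: "x \<in> lines \<Longrightarrow> r *\<^sub>R x \<in> supp"
  by (simp add: lines_def)

text \<open>The weight of \<open>x\<close> must be below 1. The complementary weight is absorbed by
  stretching \<open>y\<close> along its line, and letting the weight of \<open>x\<close> tend to 1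
  uses that the support is closed.\<close>

lemma supp_add_lines:
  assumes "x \<in> supp" "y \<in> lines"
  shows "x + y \<in> supp"
proof -
  \<comment> \<open>The shift by 2 keeps \<open>a k\<close> strictly between 0 and 1 also for
    \<open>k = 0\<close>.\<close>
  define a where "a k = 1 - 1 / (real k + 2)" for k
  have lim: "(\<lambda>k. a k *\<^sub>R x + y) \<longlonglongrightarrow> 1 *\<^sub>R x + y"
    unfolding a_def by (intro tendsto_intros) real_asymp
  have "a k *\<^sub>R x + y \<in> supp" for k
  proof -
    let ?b = "(1 - a k powr \<alpha>) powr (1 / \<alpha>)"
    have a: "0 < a k" "a k < 1"
      by (auto simp: a_def field_simps)
    then have "a k powr \<alpha> < 1"
      using a \<alpha> powr_less_mono2 [of \<alpha> "a k" 1] by simp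
    then have b: "?b powr \<alpha> = 1 - a k powr \<alpha>" "0 < ?b"
      using \<alpha> by (simp_all add: powr_powr)
    then have "a k *\<^sub>R x + ?b *\<^sub>R ((1 / ?b) *\<^sub>R y) \<in> supp"
      using a by (intro supp_combination assms(1) linesD [OF assms(2)]) auto
    with b show ?thesis by simp
  qed
  from closed_sequentially [OF closed_measure_support this lim] show ?thesis
    by simp
qed

lemma subspace_lines: "subspace lines"
  unfolding subspace_def
proof (intro conjI ballI allI)
  show "0 \<in> lines"
    by (simp add: lines_def zero_in_supp)
  show scale: "r *\<^sub>R x \<in> lines" if "x \<in> lines" for r x
    using that by (simp add: lines_def)
  show "x + y \<in> lines" if "x \<in> lines" "y \<in> lines" for x y
    unfolding lines_def
    using supp_add_lines [OF linesD [OF that(1)] scale [OF that(2)]] by (simp add: scaleR_add_right)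
qed

text \<open>An unbounded sequence in a closed star-shaped symmetric set has a limiting direction,
  which spans a line in the set.\<close>

lemma bounded_supp_orthogonal_lines:
  "bounded {x \<in> supp. \<forall>y\<in>lines. orthogonal x y}"
proof (rule ccontr)
  let ?W = "{x \<in> supp. \<forall>y\<in>lines. orthogonal x y}"
  assume unbounded: "\<not> bounded ?W"
  have "\<exists>x. x \<in> ?W \<and> real k < norm x" for k
  proof (rule ccontr)
    assume "\<nexists>x. x \<in> ?W \<and> real k < norm x"
    then have "norm x \<le> real k" if "x \<in> ?W" for x
      using that not_less by blast
    then have "bounded ?W"
      by (rule boundedI)
    with unbounded show False ..
  qed
  then have "\<forall>k. \<exists>x. x \<in> ?W \<and> real k < norm x" ..
  from choice [OF this] obtain x where x: "\<And>k. x k \<in> ?W" "\<And>k. real k < norm (x k)"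
    by blast
  define e where "e k = x k /\<^sub>R norm (x k)" for k
  have norm_x: "0 < norm (x k)" for k
    using x(2) [of k] by linarith
  have "e k \<in> sphere 0 1" for k
    using norm_x [of k] by (simp add: e_def)
  then obtain \<xi> \<rho> where \<xi>: "\<xi> \<in> sphere 0 1" and \<rho>: "strict_mono \<rho>" "(e \<circ> \<rho>) \<longlonglongrightarrow> \<xi>"
    using compact_sphere [of 0 1] unfolding compact_def by blast
  have "r *\<^sub>R \<xi> \<in> supp" for r
  proof (rule Lim_in_closed_set [OF closed_measure_support])
    show "(\<lambda>k. r *\<^sub>R (e \<circ> \<rho>) k) \<longlonglongrightarrow> r *\<^sub>R \<xi>"
      by (intro tendsto_intros \<rho>)
    show "sequentially \<noteq> bot"
      by simp
    show "\<forall>\<^sub>F k in sequentially. r *\<^sub>R (e \<circ> \<rho>) k \<in> supp"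
      using eventually_ge_at_top [of "nat \<lceil>\<bar>r\<bar>\<rceil>"]
    proof eventually_elim
      \<comment> \<open>The point is \<open>x (\<rho> k)\<close> times
        \<open>r / norm (x (\<rho> k))\<close>. This factor is at most 1 in absolute value once
        \<open>\<bar>r\<bar> \<le> k\<close>, because \<open>k \<le> \<rho> k\<close>.\<close>
      case (elim k)
      then have "\<bar>r\<bar> \<le> real k"
        by linarith
      also have "real k \<le> real (\<rho> k)"
        using seq_suble [OF \<rho>(1), of k] by simp
      also have "\<dots> \<le> norm (x (\<rho> k))"
        using x(2) [of "\<rho> k"] by simp
      finally have "(r / norm (x (\<rho> k))) *\<^sub>R x (\<rho> k) \<in> supp"
        using x(1) [of "\<rho> k"] norm_x [of "\<rho> k"] by (intro supp_scaleR_le_1) auto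
      then show ?case
        by (simp add: e_def divide_inverse)
    qed
  qed
  then have "\<xi> \<in> lines"
    by (simp add: lines_def)
  \<comment> \<open>The directions are orthogonal to \<open>lines\<close>, hence to their own limit
    \<open>\<xi>\<close>, which is impossible for a unit vector.\<close>
  then have "(e \<circ> \<rho>) k \<bullet> \<xi> = 0" for k
    using x(1) [of "\<rho> k"] by (simp add: e_def orthogonal_def)
  moreover have "(\<lambda>k. (e \<circ> \<rho>) k \<bullet> \<xi>) \<longlonglongrightarrow> \<xi> \<bullet> \<xi>"
    by (intro tendsto_intros \<rho>)
  ultimately have "\<xi> \<bullet> \<xi> = 0"
    by (simp add: LIMSEQ_const_iff)
  with \<xi> show False
    by simp
qed

text \<open>A direction \<open>v\<close> in which the law is bounded would give \<open>1 - p (s v) = O(s\<^sup>2)\<close>,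
  against the lower bound of order \<open>s powr \<alpha>\<close>.\<close>

lemma not_AE_bounded_inner:
  assumes "v \<noteq> 0"
  shows "\<not> (AE x in P. \<bar>x \<bullet> v\<bar> \<le> R)"
proof
  assume AE: "AE x in P. \<bar>x \<bullet> v\<bar> \<le> R"
  let ?d = "c * norm v powr \<alpha>"
  have d: "0 < ?d"
    using c assms by simp
  have upper: "1 - p (s *\<^sub>R v) \<le> s\<^sup>2 * R\<^sup>2 / 2" for s
  proof -
    have i: "integrable P (\<lambda>x. cos (x \<bullet> (s *\<^sub>R v)))"
      by (intro integrable_const_bound [of _ 1]) auto
    have "p (s *\<^sub>R v) = Re (vec_char P (s *\<^sub>R v))"
      by (simp add: char)
    also have "\<dots> = (LINT x|P. Re (iexp (x \<bullet> (s *\<^sub>R v))))"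
      unfolding vec_char_def by (intro integral_Re [symmetric] integrable_iexp) simp
    also have "\<dots> = (LINT x|P. cos (x \<bullet> (s *\<^sub>R v)))"
      by (simp add: Re_exp)
    finally have "1 - p (s *\<^sub>R v) = (LINT x|P. 1 - cos (x \<bullet> (s *\<^sub>R v)))"
      using i prob_space by simp
    also have "\<dots> \<le> (LINT x|P. s\<^sup>2 * R\<^sup>2 / 2)"
    proof (rule integral_mono_AE)
      show "AE x in P. 1 - cos (x \<bullet> (s *\<^sub>R v)) \<le> s\<^sup>2 * R\<^sup>2 / 2"
        using AE
      proof eventually_elim
        case (elim x)
        then have "(s * (x \<bullet> v))\<^sup>2 \<le> s\<^sup>2 * R\<^sup>2"
        proof -
          have "\<bar>x \<bullet> v\<bar>\<^sup>2 \<le> R\<^sup>2"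
            using elim by (rule power_mono) simp
          then show ?thesis
            unfolding power_mult_distrib by (intro mult_left_mono) simp_all
        qed
        then show ?case
          using one_minus_cos_le [of "s * (x \<bullet> v)"] by simp
      qed
    qed (use i in auto)
    finally show ?thesis
      by simp
  qed
  have lower: "1 - exp (- ?d * s powr \<alpha>) \<le> 1 - p (s *\<^sub>R v)" if "0 < s" for s
    using p_le [of "s *\<^sub>R v"] that by (simp add: powr_mult mult_ac)
  \<comment> \<open>After division by \<open>s powr \<alpha>\<close> the lower bound tends to
    \<open>?d\<close> and the upper bound to \<open>0\<close>, because
    \<open>\<alpha> < 2\<close>.\<close>
  have "((\<lambda>s::real. (1 - exp (- ?d * s powr \<alpha>)) / s powr \<alpha>) \<longlongrightarrow> ?d) (at_right 0)"
    using d \<alpha> by real_asymp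
  moreover have "((\<lambda>s::real. (s\<^sup>2 * R\<^sup>2 / 2) / s powr \<alpha>) \<longlongrightarrow> 0) (at_right 0)"
    using \<alpha> by real_asymp
  moreover have "\<forall>\<^sub>F s::real in at_right 0.
      (1 - exp (- ?d * s powr \<alpha>)) / s powr \<alpha> \<le> (s\<^sup>2 * R\<^sup>2 / 2) / s powr \<alpha>"
    using eventually_at_right_less [of 0]
    by eventually_elim (intro divide_right_mono order_trans [OF lower upper], auto)
  ultimately have "?d \<le> 0"
    by (intro tendsto_le [of "at_right (0::real)"]) auto
  with d show False by simp
qed

theorem supp_eq_UNIV: "supp = UNIV"
proof -
  have "lines = UNIV"
  proof (rule ccontr)
    assume "lines \<noteq> UNIV"
    then obtain v where v: "v \<noteq> 0" "\<And>y. y \<in> lines \<Longrightarrow> y \<bullet> v = 0"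
      using subspace_orthogonal_vector [OF subspace_lines] by blast
    obtain R where R: "\<And>x. x \<in> supp \<Longrightarrow> \<forall>y\<in>lines. orthogonal x y \<Longrightarrow> norm x \<le> R"
      using bounded_supp_orthogonal_lines unfolding bounded_iff by blast
    \<comment> \<open>Removing the component of \<open>x\<close> in \<open>lines\<close> keeps it in
      the support and does not change its inner product with \<open>v\<close>. The remainder is
      orthogonal to \<open>lines\<close>, hence bounded by \<open>R\<close>.\<close>
    have "\<bar>x \<bullet> v\<bar> \<le> R * norm v" if x: "x \<in> supp" for x
    proof -
      obtain y z where yz: "y \<in> span lines" "\<And>w. w \<in> span lines \<Longrightarrow> orthogonal z w" "x = y + z"
        using orthogonal_subspace_decomp_exists [of lines x] by blast
      have y: "y \<in> lines"
        using yz(1) subspace_lines span_eq_iff by blast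
      have "- y \<in> lines"
        using y subspace_lines by (rule subspace_neg [rotated])
      with x have "x + - y \<in> supp"
        by (rule supp_add_lines)
      then have "norm z \<le> R"
        using yz by (intro R) (auto simp: span_base)
      moreover have "x \<bullet> v = z \<bullet> v"
        using v(2) [OF y] yz(3) by (simp add: inner_add_left)
      ultimately show ?thesis
        using Cauchy_Schwarz_ineq2 [of z v] mult_right_mono [of "norm z" R "norm v"] by auto
    qed
    then have "AE x in P. \<bar>x \<bullet> v\<bar> \<le> R * norm v"
      using AE_in_measure_support [OF sets_P] by (auto elim: AE_mp)
    with not_AE_bounded_inner [OF v(1)] show False
      by blast
  qed
  then have "1 *\<^sub>R x \<in> supp" for x
    by (intro linesD) simp
  then show ?thesis by auto
qed

end

section \<open>The exponent of a symmetric stable process\<close>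

context
  fixes \<mu> :: "(real ^ 'n) measure" and \<alpha> :: real
  assumes \<mu>: "symmetric_spherical_measure \<mu>"
begin

lemma space_spherical: "space \<mu> = sphere 0 1"
  using \<mu> sets_eq_imp_space_eq [of \<mu> "restrict_space borel (sphere 0 1)"]
  by (simp add: symmetric_spherical_measure_def space_restrict_space)

lemma measurable_spherical [measurable]: "(\<lambda>\<xi>. \<xi>) \<in> measurable \<mu> borel"
  using \<mu> by (simp add: symmetric_spherical_measure_def measurable_restrict_space1 cong: measurable_cong_sets)

lemma measurable_uminus_spherical: "uminus \<in> measurable \<mu> \<mu>"
proof -
  have "uminus \<in> measurable (restrict_space borel (sphere 0 1)) (restrict_space borel (sphere (0 :: real ^ 'n) 1))"
    by (intro measurable_restrict_space3) auto
  then show ?thesis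
    using \<mu> by (simp add: symmetric_spherical_measure_def cong: measurable_cong_sets)
qed

lemma distr_uminus_spherical: "distr \<mu> \<mu> uminus = \<mu>"
proof (rule measure_eqI)
  fix D assume "D \<in> sets (distr \<mu> \<mu> uminus)"
  then have D: "D \<in> sets \<mu>" by simp
  have "uminus -` D \<inter> space \<mu> = uminus ` D"
    using sets.sets_into_space [OF D] by (auto simp: space_spherical intro: image_eqI [of _ _ "- _"])
  then show "emeasure (distr \<mu> \<mu> uminus) D = emeasure \<mu> D"
    using D \<mu> by (simp add: emeasure_distr measurable_uminus_spherical symmetric_spherical_measure_def)
qed simp

lemma space_stable_levy_measure: "space (stable_levy_measure \<alpha> \<mu>) = UNIV"
  using sets_eq_imp_space_eq [OF sets_stable_levy_measure] by simp

text \<open>In polar coordinates the reflection acts on the direction alone, where it preserves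
  \<open>\<mu>\<close>.\<close>

lemma distr_uminus_stable_levy_measure:
  "distr (stable_levy_measure \<alpha> \<mu>) borel uminus = stable_levy_measure \<alpha> \<mu>"
proof (rule measure_eqI)
  fix D :: "(real ^ 'n) set" assume "D \<in> sets (distr (stable_levy_measure \<alpha> \<mu>) borel uminus)"
  then have D [measurable]: "D \<in> sets borel" by simp
  define h where "h \<xi> = (\<integral>\<^sup>+r\<in>{0<..}. indicator D (r *\<^sub>R \<xi>) * ennreal (1 / r powr (1 + \<alpha>)) \<partial>lborel)" for \<xi>
  have [measurable]: "h \<in> borel_measurable \<mu>"
    unfolding h_def [abs_def] by measurable
  have D': "uminus -` D \<in> sets borel"
    using measurable_sets [of uminus borel borel D] by simp
  have "emeasure (distr (stable_levy_measure \<alpha> \<mu>) borel uminus) D =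
      emeasure (stable_levy_measure \<alpha> \<mu>) (uminus -` D)"
    by (subst emeasure_distr)
      (simp_all add: space_stable_levy_measure measurable_cong_sets [OF sets_stable_levy_measure refl])
  also have "\<dots> = (\<integral>\<^sup>+\<xi>. h (- \<xi>) \<partial>\<mu>)"
    unfolding emeasure_stable_levy_measure [OF \<mu> D'] h_def by (simp add: indicator_def)
  also have "\<dots> = (\<integral>\<^sup>+\<xi>. h \<xi> \<partial>distr \<mu> \<mu> uminus)"
    by (subst nn_integral_distr) (simp_all add: measurable_uminus_spherical)
  also have "\<dots> = emeasure (stable_levy_measure \<alpha> \<mu>) D"
    unfolding distr_uminus_spherical h_def by (rule emeasure_stable_levy_measure [OF \<mu> D, symmetric])
  finally show "emeasure (distr (stable_levy_measure \<alpha> \<mu>) borel uminus) D =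
      emeasure (stable_levy_measure \<alpha> \<mu>) D" .
qed simp

text \<open>The dilation acts on the radius alone. Substituting \<open>r / c\<close> gives a
  Jacobian \<open>1 / c\<close> and a factor \<open>c powr (1 + \<alpha>)\<close> from the
  density.\<close>

lemma distr_scaleR_stable_levy_measure:
  assumes c: "0 < c"
  shows "distr (stable_levy_measure \<alpha> \<mu>) borel (\<lambda>y. c *\<^sub>R y) =
    scale_measure (ennreal (c powr \<alpha>)) (stable_levy_measure \<alpha> \<mu>)"
proof (rule measure_eqI)
  fix D :: "(real ^ 'n) set" assume "D \<in> sets (distr (stable_levy_measure \<alpha> \<mu>) borel (\<lambda>y. c *\<^sub>R y))"
  then have D [measurable]: "D \<in> sets borel" by simp
  let ?h = "\<lambda>\<xi>. \<integral>\<^sup>+r\<in>{0<..}. indicator D (r *\<^sub>R \<xi>) * ennreal (1 / r powr (1 + \<alpha>)) \<partial>lborel"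
  have D': "(\<lambda>y. c *\<^sub>R y) -` D \<in> sets borel"
    using measurable_sets [of "\<lambda>y. c *\<^sub>R y" borel borel D] by simp
  have inner: "(\<integral>\<^sup>+r\<in>{0<..}. indicator ((\<lambda>y. c *\<^sub>R y) -` D) (r *\<^sub>R \<xi>) * ennreal (1 / r powr (1 + \<alpha>)) \<partial>lborel)
      = ennreal (c powr \<alpha>) * ?h \<xi>" for \<xi>
  proof -
    have "(\<integral>\<^sup>+r\<in>{0<..}. indicator ((\<lambda>y. c *\<^sub>R y) -` D) (r *\<^sub>R \<xi>) * ennreal (1 / r powr (1 + \<alpha>)) \<partial>lborel) =
        (\<integral>\<^sup>+r. indicator D ((c * r) *\<^sub>R \<xi>) * ennreal (1 / r powr (1 + \<alpha>)) * indicator {0<..} r \<partial>lborel)"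
      by (simp add: indicator_def)
    also have "\<dots> = ennreal \<bar>1 / c\<bar> * (\<integral>\<^sup>+r. indicator D ((c * (0 + 1 / c * r)) *\<^sub>R \<xi>) *
        ennreal (1 / (0 + 1 / c * r) powr (1 + \<alpha>)) * indicator {0<..} (0 + 1 / c * r) \<partial>lborel)"
      using c by (intro nn_integral_real_affine) auto
    also have "\<dots> = ennreal \<bar>1 / c\<bar> * (\<integral>\<^sup>+r. ennreal (c powr (1 + \<alpha>)) *
        (indicator D (r *\<^sub>R \<xi>) * ennreal (1 / r powr (1 + \<alpha>)) * indicator {0<..} r) \<partial>lborel)"
    proof (intro arg_cong [where f = "\<lambda>x. ennreal \<bar>1 / c\<bar> * x"] nn_integral_cong)
      fix r :: real
      show "indicator D ((c * (0 + 1 / c * r)) *\<^sub>R \<xi>) * ennreal (1 / (0 + 1 / c * r) powr (1 + \<alpha>)) *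
          indicator {0<..} (0 + 1 / c * r) =
          ennreal (c powr (1 + \<alpha>)) * (indicator D (r *\<^sub>R \<xi>) * ennreal (1 / r powr (1 + \<alpha>)) * indicator {0<..} r)"
      proof (cases "0 < r")
        case True
        then have "1 / (r / c) powr (1 + \<alpha>) = c powr (1 + \<alpha>) * (1 / r powr (1 + \<alpha>))"
          using c by (simp add: powr_divide)
        with True c show ?thesis
          by (simp add: ennreal_mult [symmetric] indicator_def)
      qed (use c in \<open>simp add: zero_less_divide_iff\<close>)
    qed
    also have "\<dots> = ennreal \<bar>1 / c\<bar> * (ennreal (c powr (1 + \<alpha>)) * ?h \<xi>)"
      by (subst nn_integral_cmult) simp_all
    also have "\<dots> = ennreal (c powr \<alpha>) * ?h \<xi>"
    proof -
      have "ennreal \<bar>1 / c\<bar> * ennreal (c powr (1 + \<alpha>)) = ennreal (c powr \<alpha>)"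
        using c by (simp add: ennreal_mult [symmetric] powr_add)
      then show ?thesis
        by (simp add: mult.assoc [symmetric])
    qed
    finally show ?thesis .
  qed
  have "emeasure (distr (stable_levy_measure \<alpha> \<mu>) borel (\<lambda>y. c *\<^sub>R y)) D =
      emeasure (stable_levy_measure \<alpha> \<mu>) ((\<lambda>y. c *\<^sub>R y) -` D)"
    by (subst emeasure_distr)
      (simp_all add: space_stable_levy_measure measurable_cong_sets [OF sets_stable_levy_measure refl])
  also have "\<dots> = (\<integral>\<^sup>+\<xi>. ennreal (c powr \<alpha>) * ?h \<xi> \<partial>\<mu>)"
    unfolding emeasure_stable_levy_measure [OF \<mu> D'] inner ..
  also have "\<dots> = ennreal (c powr \<alpha>) * (\<integral>\<^sup>+\<xi>. ?h \<xi> \<partial>\<mu>)"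
    by (rule nn_integral_cmult) measurable
  also have "\<dots> = emeasure (scale_measure (ennreal (c powr \<alpha>)) (stable_levy_measure \<alpha> \<mu>)) D"
    by (simp add: emeasure_stable_levy_measure [OF \<mu> D])
  finally show "emeasure (distr (stable_levy_measure \<alpha> \<mu>) borel (\<lambda>y. c *\<^sub>R y)) D =
      emeasure (scale_measure (ennreal (c powr \<alpha>)) (stable_levy_measure \<alpha> \<mu>)) D" .
qed simp

end

section \<open>The exponent as a real, even and homogeneous function\<close>

context nondegenerate_symmetric_stable_process
begin

abbreviation \<nu> :: "(real ^ 'b) measure" where
  "\<nu> \<equiv> stable_levy_measure \<alpha> \<mu>"

definition \<psi> :: "real ^ 'b \<Rightarrow> real" where
  "\<psi> u = Re (stable_exponent \<alpha> \<mu> u)"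

text \<open>The Bochner integral of a non-integrable function is \<open>0\<close> by convention,
  whereas non-degeneracy makes this integral nonzero for \<open>u \<noteq> 0\<close>. For
  \<open>u = 0\<close> the integrand vanishes.\<close>

lemma integrable_exponent:
  "complex_integrable \<nu> (\<lambda>y. iexp (u \<bullet> y) - 1 -
    \<i> * complex_of_real ((u \<bullet> y) * indicator {y. norm y \<le> 1} y))"
proof (cases "u = 0")
  case False
  obtain C where C: "0 < C" "\<And>u. C * norm u powr \<alpha> \<le> Re (stable_exponent \<alpha> \<mu> u)"
    using nondegenerate by blast
  have "0 < C * norm u powr \<alpha>"
    using C(1) False by simp
  then have "stable_exponent \<alpha> \<mu> u \<noteq> 0"
    using C(2) [of u] by auto
  then show ?thesis
    unfolding stable_exponent_def using not_integrable_integral_eq by fastforce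
qed simp

lemma integrable_one_minus_cos: "integrable \<nu> (\<lambda>y. 1 - cos (u \<bullet> y))"
proof -
  have "integrable \<nu> (\<lambda>y. - Re (iexp (u \<bullet> y) - 1 -
      \<i> * complex_of_real ((u \<bullet> y) * indicator {y. norm y \<le> 1} y)))"
    by (intro integrable_minus integrable_Re integrable_exponent)
  then show ?thesis
    by (simp add: Re_exp)
qed

lemma \<psi>_eq: "\<psi> u = (LINT y|\<nu>. 1 - cos (u \<bullet> y))"
proof -
  have "\<psi> u = - (LINT y|\<nu>. Re (iexp (u \<bullet> y) - 1 -
      \<i> * complex_of_real ((u \<bullet> y) * indicator {y. norm y \<le> 1} y)))"
    unfolding \<psi>_def stable_exponent_def
    by (simp only: integral_Re [OF integrable_exponent] uminus_complex.simps)
  then show ?thesis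
    by (simp add: Re_exp flip: integral_minus)
qed

text \<open>The imaginary part of the integrand is odd in \<open>y\<close>, and \<open>\<nu>\<close>
  is symmetric.\<close>

lemma stable_exponent_eq: "stable_exponent \<alpha> \<mu> u = complex_of_real (\<psi> u)"
proof -
  define h where "h y = sin (u \<bullet> y) - (u \<bullet> y) * indicator {y. norm y \<le> 1} y" for y
  have Im_h: "Im (iexp (u \<bullet> y) - 1 -
      \<i> * complex_of_real ((u \<bullet> y) * indicator {y. norm y \<le> 1} y)) = h y" for y
    by (simp add: h_def Im_exp)
  have [measurable]: "h \<in> borel_measurable borel"
    unfolding h_def [abs_def] by measurable
  have odd: "h (- y) = - h y" for y
    by (simp add: h_def indicator_def)
  have "(LINT y|\<nu>. h y) = (LINT y|distr \<nu> borel uminus. h y)"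
    by (simp only: distr_uminus_stable_levy_measure [OF spherical_measure])
  also have "\<dots> = (LINT y|\<nu>. h (- y))"
    by (rule integral_distr) (simp_all add: measurable_cong_sets [OF sets_stable_levy_measure refl])
  also have "\<dots> = - (LINT y|\<nu>. h y)"
    by (simp only: odd integral_minus)
  finally have "(LINT y|\<nu>. h y) = 0"
    by simp
  then have "Im (stable_exponent \<alpha> \<mu> u) = 0"
    unfolding stable_exponent_def uminus_complex.simps integral_Im [OF integrable_exponent, symmetric] Im_h
    by simp
  then show ?thesis
    by (simp add: \<psi>_def complex_eq_iff)
qed

lemma \<psi>_minus: "\<psi> (- u) = \<psi> u"
  by (simp add: \<psi>_eq)

text \<open>The factor \<open>c\<close> is moved from \<open>u\<close> to \<open>y\<close> and from
  there into the scaling of \<open>\<nu>\<close>. As \<open>1 - cos\<close> is nonnegative, the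
  change of measure is done with nonnegative integrals.\<close>

lemma \<psi>_scaleR:
  assumes "0 < c"
  shows "\<psi> (c *\<^sub>R u) = c powr \<alpha> * \<psi> u"
proof -
  have psi_nn: "ennreal (\<psi> u) = (\<integral>\<^sup>+y. ennreal (1 - cos (u \<bullet> y)) \<partial>\<nu>)" for u
    unfolding \<psi>_eq by (intro nn_integral_eq_integral [symmetric] integrable_one_minus_cos) simp
  have psi_nonneg: "0 \<le> \<psi> u" for u
    unfolding \<psi>_eq by (intro integral_nonneg_AE) simp
  have "ennreal (\<psi> (c *\<^sub>R u)) = (\<integral>\<^sup>+y. ennreal (1 - cos (u \<bullet> (c *\<^sub>R y))) \<partial>\<nu>)"
    by (simp add: psi_nn)
  also have "\<dots> = (\<integral>\<^sup>+y. ennreal (1 - cos (u \<bullet> y)) \<partial>distr \<nu> borel (\<lambda>y. c *\<^sub>R y))"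
    by (subst nn_integral_distr) (simp_all add: measurable_cong_sets [OF sets_stable_levy_measure refl])
  also have "\<dots> = ennreal (c powr \<alpha>) * ennreal (\<psi> u)"
    unfolding distr_scaleR_stable_levy_measure [OF spherical_measure assms]
    by (subst nn_integral_scale_measure)
      (simp_all add: psi_nn measurable_cong_sets [OF sets_stable_levy_measure refl])
  finally show ?thesis
    using psi_nonneg by (simp add: ennreal_mult [symmetric])
qed

end

section \<open>Existence of the stochastic integral\<close>

definition riemann_sum ::
  "(real \<Rightarrow> 'w \<Rightarrow> real ^ 'n) \<Rightarrow> (real \<Rightarrow> real ^ 'n ^ 'n) \<Rightarrow> nat \<Rightarrow> (nat \<Rightarrow> real) \<Rightarrow> 'w \<Rightarrow> real ^ 'n" where
  "riemann_sum Z F N s \<omega> = (\<Sum>i<N. F (s i) *v (Z (s (Suc i)) \<omega> - Z (s i) \<omega>))"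

lemma riemann_sum_nth:
  "riemann_sum Z F N s \<omega> $ i =
    (\<Sum>j\<in>UNIV. \<Sum>k<N. F (s k) $ i $ j * (Z (s (Suc k)) \<omega> $ j - Z (s k) \<omega> $ j))"
  unfolding riemann_sum_def
  by (subst sum.swap) (simp add: matrix_vector_mult_def)

text \<open>The index \<open>k\<close> stands for \<open>Suc k\<close> pieces, so the denominator is
  never zero.\<close>

definition uniform_partition :: "real \<Rightarrow> nat \<Rightarrow> nat \<Rightarrow> real" where
  "uniform_partition t k i = t * real i / real (Suc k)"

lemma uniform_partition:
  assumes "0 \<le> t"
  shows "uniform_partition t k 0 = 0" "uniform_partition t k (Suc k) = t"
    "0 \<le> uniform_partition t k i"
    "uniform_partition t k i \<le> uniform_partition t k (Suc i)"
    "uniform_partition t k (Suc i) - uniform_partition t k i = t / real (Suc k)"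
proof -
  show 5: "uniform_partition t k (Suc i) - uniform_partition t k i = t / real (Suc k)"
    by (simp add: uniform_partition_def diff_divide_distrib [symmetric] algebra_simps)
  have "0 \<le> t / real (Suc k)"
    using assms by simp
  with 5 show "uniform_partition t k i \<le> uniform_partition t k (Suc i)"
    by linarith
qed (use assms in \<open>simp_all add: uniform_partition_def del: of_nat_Suc\<close>)

lemma LIMSEQ_divide_Suc: "(\<lambda>k. t / real (Suc k)) \<longlonglongrightarrow> 0"
  using tendsto_mult [OF tendsto_const LIMSEQ_inverse_real_of_nat, of t] by (simp add: divide_inverse)

text \<open>Almost surely the indicators of the events vanish eventually; dominated convergence then
  applies to them.\<close>

lemma (in prob_space) AE_tendsto_imp_prob_tendsto:
  fixes Y :: "nat \<Rightarrow> 'a \<Rightarrow> 'b::{second_countable_topology, real_normed_vector}"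
  assumes [measurable]: "\<And>k. Y k \<in> borel_measurable M"
    and AE: "AE \<omega> in M. (\<lambda>k. Y k \<omega>) \<longlonglongrightarrow> 0" and "0 < \<epsilon>"
  shows "(\<lambda>k. prob {\<omega> \<in> space M. \<epsilon> < norm (Y k \<omega>)}) \<longlonglongrightarrow> 0"
proof -
  have "(\<lambda>k. LINT \<omega>|M. indicator {\<omega> \<in> space M. \<epsilon> < norm (Y k \<omega>)} \<omega>) \<longlonglongrightarrow> (LINT \<omega>|M. (0::real))"
  proof (rule integral_dominated_convergence [where w = "\<lambda>_. 1"])
    show "AE \<omega> in M. (\<lambda>k. indicat_real {\<omega> \<in> space M. \<epsilon> < norm (Y k \<omega>)} \<omega>) \<longlonglongrightarrow> 0"
      using AE
    proof eventually_elim
      case (elim \<omega>)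
      have "\<forall>\<^sub>F k in sequentially. norm (Y k \<omega>) < \<epsilon>"
        using order_tendstoD(2) [OF tendsto_norm [OF elim]] \<open>0 < \<epsilon>\<close> by simp
      then have "\<forall>\<^sub>F k in sequentially. indicat_real {\<omega> \<in> space M. \<epsilon> < norm (Y k \<omega>)} \<omega> = 0"
        by eventually_elim simp
      then show ?case
        by (rule tendsto_eventually)
    qed
  qed (auto simp: indicator_def)
  then show ?thesis
    by simp
qed

section \<open>Convergence of Riemann sums along paths and in probability\<close>

context levy_process
begin

lemma increment_measurable:
  assumes "0 \<le> a" "a \<le> b"
  shows "(\<lambda>\<omega>. Z b \<omega> - Z a \<omega>) \<in> borel_measurable M"
  using assms by (intro borel_measurable_diff random_variable_Z) auto

lemma partition_nonneg:
  fixes s :: "nat \<Rightarrow> real"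
  assumes "0 \<le> s 0" "\<And>i. i < N \<Longrightarrow> s i \<le> s (Suc i)" "i \<le> N"
  shows "0 \<le> s i"
  using partition_mono [of N s 0 i] assms by auto

lemma riemann_sum_measurable:
  assumes "0 \<le> s 0" "\<And>i. i < N \<Longrightarrow> s i \<le> s (Suc i)"
  shows "riemann_sum Z F N s \<in> borel_measurable M"
proof -
  have "(\<lambda>\<omega>. F (s i) *v (Z (s (Suc i)) \<omega> - Z (s i) \<omega>)) \<in> borel_measurable M" if "i < N" for i
  proof (rule borel_measurable_continuous_on [where f = "\<lambda>x. F (s i) *v x"])
    show "continuous_on UNIV ((*v) (F (s i)))"
      by (intro linear_continuous_on matrix_vector_mul_bounded_linear)
    show "(\<lambda>\<omega>. Z (s (Suc i)) \<omega> - Z (s i) \<omega>) \<in> borel_measurable M"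
      using that assms(2) partition_nonneg [of s N i, OF assms] by (intro increment_measurable) auto
  qed
  then show ?thesis
    unfolding riemann_sum_def [abs_def] by (intro borel_measurable_sum) simp
qed

text \<open>The quantifiers over partitions stand inside \<open>AE\<close>: the exceptional set
  depends on the path properties only, so one null set and one limit \<open>L\<close> serve all
  partition sequences.\<close>

lemma AE_riemann_sum_tendsto:
  fixes F F' :: "real \<Rightarrow> real ^ 'n ^ 'n"
  assumes F: "\<And>x i j. ((\<lambda>x. F x $ i $ j) has_real_derivative F' x $ i $ j) (at x)"
    and F': "\<And>i j. continuous_on UNIV (\<lambda>x. F' x $ i $ j)"
  shows "\<exists>L. AE \<omega> in M. \<forall>N s d.
    (\<forall>k. s k 0 = 0 \<and> s k (N k) = t \<and> (\<forall>i<N k. s k i \<le> s k (Suc i) \<and> s k (Suc i) - s k i \<le> d k)) \<longrightarrow>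
    d \<longlonglongrightarrow> 0 \<longrightarrow> (\<lambda>k. riemann_sum Z F (N k) (s k) \<omega>) \<longlonglongrightarrow> L \<omega>"
proof -
  \<comment> \<open>The value given by integration by parts in each entry, in which the path is
    integrated against \<open>F'\<close>.\<close>
  define L where "L \<omega> = (\<chi> i. \<Sum>j\<in>UNIV. F t $ i $ j * Z t \<omega> $ j - F 0 $ i $ j * Z 0 \<omega> $ j -
    (LINT r|lborel. indicator {0<..t} r * (F' r $ i $ j * Z r \<omega> $ j)))" for \<omega>
  have "AE \<omega> in M. \<forall>N s d.
    (\<forall>k. s k 0 = 0 \<and> s k (N k) = t \<and> (\<forall>i<N k. s k i \<le> s k (Suc i) \<and> s k (Suc i) - s k i \<le> d k)) \<longrightarrow>
    d \<longlonglongrightarrow> 0 \<longrightarrow> (\<lambda>k. riemann_sum Z F (N k) (s k) \<omega>) \<longlonglongrightarrow> L \<omega>"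
    using cadlag_paths
  proof eventually_elim
    case (elim \<omega>)
    have right: "continuous (at_right r) (\<lambda>s. Z s \<omega>)" if "0 \<le> r" for r
      using elim that by blast
    have "\<exists>B. \<forall>r. 0 \<le> r \<and> r \<le> t \<longrightarrow> norm (Z r \<omega>) \<le> B"
      using elim by (intro cadlag_bounded) blast+
    then obtain B where B: "\<And>r. 0 \<le> r \<Longrightarrow> r \<le> t \<Longrightarrow> norm (Z r \<omega>) \<le> B"
      by blast
    show ?case
    proof (intro allI impI)
      fix N :: "nat \<Rightarrow> nat" and s :: "nat \<Rightarrow> nat \<Rightarrow> real" and d :: "nat \<Rightarrow> real"
      assume s: "\<forall>k. s k 0 = 0 \<and> s k (N k) = t \<and>
          (\<forall>i<N k. s k i \<le> s k (Suc i) \<and> s k (Suc i) - s k i \<le> d k)" and d: "d \<longlonglongrightarrow> 0"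
      show "(\<lambda>k. riemann_sum Z F (N k) (s k) \<omega>) \<longlonglongrightarrow> L \<omega>"
      proof (rule vec_tendstoI)
        fix i
        have "(\<lambda>k. \<Sum>l<N k. F (s k l) $ i $ j * (Z (s k (Suc l)) \<omega> $ j - Z (s k l) \<omega> $ j)) \<longlonglongrightarrow>
            F t $ i $ j * Z t \<omega> $ j - F 0 $ i $ j * Z 0 \<omega> $ j -
            (LINT r|lborel. indicator {0<..t} r * (F' r $ i $ j * Z r \<omega> $ j))" for j
        proof (rule riemann_stieltjes_tendsto [OF F F' _ _ _ _ _ _ d])
          show "\<bar>Z r \<omega> $ j\<bar> \<le> B" if "0 \<le> r" "r \<le> t" for r
            using component_le_norm_cart [of "Z r \<omega>" j] B [OF that] by linarith
          show "continuous (at_right r) (\<lambda>r. Z r \<omega> $ j)" if "0 \<le> r" for r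
            using right [OF that] by (rule bounded_linear.continuous [OF bounded_linear_vec_nth])
        qed (use s in blast)+
        then show "(\<lambda>k. riemann_sum Z F (N k) (s k) \<omega> $ i) \<longlonglongrightarrow> L \<omega> $ i"
          unfolding riemann_sum_nth L_def vec_lambda_beta by (rule tendsto_sum)
      qed
    qed
  qed
  then show ?thesis
    by (intro exI [of _ L])
qed

lemma has_stochastic_integral_exists:
  fixes F F' :: "real \<Rightarrow> real ^ 'n ^ 'n"
  assumes F: "\<And>x i j. ((\<lambda>x. F x $ i $ j) has_real_derivative F' x $ i $ j) (at x)"
    and F': "\<And>i j. continuous_on UNIV (\<lambda>x. F' x $ i $ j)" and t: "0 \<le> t"
  shows "\<exists>X. has_stochastic_integral M Z F 0 t X"
proof -
  obtain L where L: "AE \<omega> in M. \<forall>N s d.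
    (\<forall>k. s k 0 = 0 \<and> s k (N k) = t \<and> (\<forall>i<N k. s k i \<le> s k (Suc i) \<and> s k (Suc i) - s k i \<le> d k)) \<longrightarrow>
    d \<longlonglongrightarrow> 0 \<longrightarrow> (\<lambda>k. riemann_sum Z F (N k) (s k) \<omega>) \<longlonglongrightarrow> L \<omega>"
    using AE_riemann_sum_tendsto [OF F F'] by blast
  \<comment> \<open>Nothing is known about measurability of \<open>L\<close>, so it is replaced by
    an almost surely equal limit of measurable Riemann sums along one fixed sequence of
    partitions.\<close>
  define X where "X \<omega> = lim (\<lambda>k. riemann_sum Z F (Suc k) (uniform_partition t k) \<omega>)" for \<omega>
  have X_meas: "X \<in> borel_measurable M"
    unfolding X_def [abs_def] using uniform_partition [OF t]
    by (intro borel_measurable_lim_metric riemann_sum_measurable) simp_all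
  have XL: "AE \<omega> in M. X \<omega> = L \<omega>"
    using L
  proof eventually_elim
    case (elim \<omega>)
    have "(\<lambda>k. riemann_sum Z F (Suc k) (uniform_partition t k) \<omega>) \<longlonglongrightarrow> L \<omega>"
      by (rule elim [rule_format, where s = "uniform_partition t" and N = Suc, OF _ LIMSEQ_divide_Suc [of t]])
        (simp add: uniform_partition [OF t])
    then show ?case
      unfolding X_def by (rule limI)
  qed
  have "\<exists>\<delta>>0. \<forall>N s. s 0 = 0 \<and> s N = t \<and> (\<forall>i<N. s i \<le> s (Suc i) \<and> s (Suc i) - s i < \<delta>) \<longrightarrow>
      prob {\<omega> \<in> space M. \<epsilon> < norm (riemann_sum Z F N s \<omega> - X \<omega>)} < \<eta>"
    if "0 < \<epsilon>" "0 < \<eta>" for \<epsilon> \<eta>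
  \<comment> \<open>If no \<open>\<delta>\<close> works, each mesh bound \<open>1 / Suc k\<close>
    admits a bad partition. The resulting sequence contradicts almost sure convergence along all
    sequences with vanishing mesh.\<close>
  proof (rule ccontr)
    let ?bad = "\<lambda>\<delta> N s. s 0 = 0 \<and> s N = t \<and> (\<forall>i<N. s i \<le> s (Suc i) \<and> s (Suc i) - s i < \<delta>) \<and>
      \<not> prob {\<omega> \<in> space M. \<epsilon> < norm (riemann_sum Z F N s \<omega> - X \<omega>)} < \<eta>"
    assume *: "\<not> ?thesis"
    have "\<exists>Ns. ?bad (1 / real (Suc k)) (fst Ns) (snd Ns)" for k
    proof -
      have "0 < 1 / real (Suc k)"
        by simp
      with * have "\<exists>N s. ?bad (1 / real (Suc k)) N s"
        by blast
      then show ?thesis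
        by simp
    qed
    then have "\<forall>k. \<exists>Ns. ?bad (1 / real (Suc k)) (fst Ns) (snd Ns)" ..
    from choice [OF this] obtain Ns
      where Ns: "\<And>k. ?bad (1 / real (Suc k)) (fst (Ns k)) (snd (Ns k))"
      by blast
    define N s where "N k = fst (Ns k)" and "s k = snd (Ns k)" for k
    have bad: "?bad (1 / real (Suc k)) (N k) (s k)" for k
      unfolding N_def s_def by (rule Ns)
    have "(\<lambda>k. prob {\<omega> \<in> space M. \<epsilon> < norm (riemann_sum Z F (N k) (s k) \<omega> - X \<omega>)}) \<longlonglongrightarrow> 0"
    proof (rule AE_tendsto_imp_prob_tendsto [OF _ _ \<open>0 < \<epsilon>\<close>])
      show "(\<lambda>\<omega>. riemann_sum Z F (N k) (s k) \<omega> - X \<omega>) \<in> borel_measurable M" for k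
        using bad [of k] by (intro borel_measurable_diff X_meas riemann_sum_measurable) simp_all
      show "AE \<omega> in M. (\<lambda>k. riemann_sum Z F (N k) (s k) \<omega> - X \<omega>) \<longlonglongrightarrow> 0"
        using L XL
      proof eventually_elim
        case (elim \<omega>)
        have "(\<lambda>k. riemann_sum Z F (N k) (s k) \<omega>) \<longlonglongrightarrow> L \<omega>"
          using bad by (intro elim(1) [rule_format, OF _ LIMSEQ_divide_Suc [of 1]]) (auto intro: less_imp_le)
        with elim(2) show ?case
          by (simp add: LIM_zero)
      qed
    qed
    then have "\<forall>\<^sub>F k in sequentially.
        prob {\<omega> \<in> space M. \<epsilon> < norm (riemann_sum Z F (N k) (s k) \<omega> - X \<omega>)} < \<eta>"
      using \<open>0 < \<eta>\<close> by (rule order_tendstoD)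
    then show False
      using bad by (auto simp: eventually_sequentially)
  qed
  then show ?thesis
    unfolding has_stochastic_integral_def riemann_sum_def using X_meas by blast
qed

end

section \<open>The law of the stochastic integral\<close>

lemma norm_iexp_diff_le: "norm (iexp x - iexp y) \<le> \<bar>x - y\<bar>"
proof -
  have "iexp x - iexp y = iexp y * (iexp (x - y) - 1)"
    by (simp add: algebra_simps flip: exp_add)
  then have "norm (iexp x - iexp y) = norm (iexp (x - y) - 1)"
    by (simp only: norm_mult norm_exp_i_times mult_1)
  also have "\<dots> \<le> \<bar>x - y\<bar>"
    using iexp_approx1 [of "x - y" 0] by simp
  finally show ?thesis .
qed

text \<open>Off the event of a large deviation the integrands are close by the Lipschitz bound
  \<open>norm_iexp_diff_le\<close>; on it they differ by at most 2.\<close>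

lemma (in prob_space) char_tendsto_in_prob:
  fixes S :: "nat \<Rightarrow> 'a \<Rightarrow> real ^ 'n" and X :: "'a \<Rightarrow> real ^ 'n"
  assumes [measurable]: "\<And>k. S k \<in> borel_measurable M" "X \<in> borel_measurable M"
    and lim: "\<And>\<epsilon>. 0 < \<epsilon> \<Longrightarrow> (\<lambda>k. prob {\<omega> \<in> space M. \<epsilon> < norm (S k \<omega> - X \<omega>)}) \<longlonglongrightarrow> 0"
  shows "(\<lambda>k. CLINT \<omega>|M. iexp (S k \<omega> \<bullet> u)) \<longlonglongrightarrow> (CLINT \<omega>|M. iexp (X \<omega> \<bullet> u))"
proof (rule LIMSEQ_I)
  fix r :: real assume "0 < r"
  \<comment> \<open>Adding 1 permits \<open>u = 0\<close> in the division. The resulting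
    \<open>\<epsilon>\<close> makes the contribution off the event at most
    \<open>r / 2\<close>.\<close>
  define n where "n = norm u + 1"
  have "0 < n"
    by (simp add: n_def add_nonneg_pos)
  define \<epsilon> where "\<epsilon> = r / (2 * n)"
  have "0 < \<epsilon>"
    using \<open>0 < r\<close> \<open>0 < n\<close> by (simp add: \<epsilon>_def)
  have \<epsilon>_norm: "\<epsilon> * norm u \<le> r / 2"
  proof -
    have "\<epsilon> * norm u \<le> \<epsilon> * n"
      using \<open>0 < \<epsilon>\<close> by (intro mult_left_mono) (auto simp: n_def)
    also have "\<dots> = r / 2"
      using \<open>0 < n\<close> by (simp add: \<epsilon>_def)
    finally show ?thesis .
  qed
  let ?A = "\<lambda>k. {\<omega> \<in> space M. \<epsilon> < norm (S k \<omega> - X \<omega>)}"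
  have int: "complex_integrable M (\<lambda>\<omega>. iexp (Y \<omega> \<bullet> u))" if [measurable]: "Y \<in> borel_measurable M" for Y
    by (rule integrable_iexp) measurable
  have bound: "norm ((CLINT \<omega>|M. iexp (S k \<omega> \<bullet> u)) - (CLINT \<omega>|M. iexp (X \<omega> \<bullet> u))) \<le>
      r / 2 + 2 * prob (?A k)" for k
  proof -
    have "norm ((CLINT \<omega>|M. iexp (S k \<omega> \<bullet> u)) - (CLINT \<omega>|M. iexp (X \<omega> \<bullet> u))) =
        norm (CLINT \<omega>|M. iexp (S k \<omega> \<bullet> u) - iexp (X \<omega> \<bullet> u))"
      by (subst Bochner_Integration.integral_diff) (simp_all add: int)
    also have "\<dots> \<le> (LINT \<omega>|M. norm (iexp (S k \<omega> \<bullet> u) - iexp (X \<omega> \<bullet> u)))"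
      by (rule integral_norm_bound)
    also have "\<dots> \<le> (LINT \<omega>|M. r / 2 + 2 * indicator (?A k) \<omega>)"
    proof (rule integral_mono)
      show "integrable M (\<lambda>\<omega>. norm (iexp (S k \<omega> \<bullet> u) - iexp (X \<omega> \<bullet> u)))"
        by (intro integrable_norm Bochner_Integration.integrable_diff int assms)
      show "integrable M (\<lambda>\<omega>. r / 2 + 2 * indicator (?A k) \<omega>)"
        by (intro Bochner_Integration.integrable_add integrable_mult_right integrable_real_indicator)
          (simp_all add: emeasure_eq_measure)
      fix \<omega> assume \<omega>: "\<omega> \<in> space M"
      show "norm (iexp (S k \<omega> \<bullet> u) - iexp (X \<omega> \<bullet> u)) \<le> r / 2 + 2 * indicator (?A k) \<omega>"
      proof (cases "\<omega> \<in> ?A k")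
        case True
        have "norm (iexp (S k \<omega> \<bullet> u) - iexp (X \<omega> \<bullet> u)) \<le>
            norm (iexp (S k \<omega> \<bullet> u)) + norm (iexp (X \<omega> \<bullet> u))"
          by (rule norm_triangle_ineq4)
        with True \<open>0 < r\<close> show ?thesis
          by simp
      next
        case False
        then have "norm (S k \<omega> - X \<omega>) \<le> \<epsilon>"
          using \<omega> by simp
        have "norm (iexp (S k \<omega> \<bullet> u) - iexp (X \<omega> \<bullet> u)) \<le> \<bar>(S k \<omega> - X \<omega>) \<bullet> u\<bar>"
          using norm_iexp_diff_le by (simp only: inner_diff_left)
        also have "\<dots> \<le> norm (S k \<omega> - X \<omega>) * norm u"
          by (rule Cauchy_Schwarz_ineq2)
        also have "\<dots> \<le> \<epsilon> * norm u"
          using \<open>norm (S k \<omega> - X \<omega>) \<le> \<epsilon>\<close> by (intro mult_right_mono) auto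
        also note \<epsilon>_norm
        finally show ?thesis
          using False by simp
      qed
    qed
    also have "\<dots> = r / 2 + 2 * prob (?A k)"
      by (subst Bochner_Integration.integral_add)
        (auto simp: prob_space intro!: integrable_mult_right integrable_real_indicator simp: emeasure_eq_measure)
    finally show ?thesis .
  qed
  have "\<forall>\<^sub>F k in sequentially. prob (?A k) < r / 4"
    using lim [OF \<open>0 < \<epsilon>\<close>] \<open>0 < r\<close> by (intro order_tendstoD(2)) auto
  then obtain K where "\<And>k. K \<le> k \<Longrightarrow> prob (?A k) < r / 4"
    by (auto simp: eventually_sequentially)
  then have "norm ((CLINT \<omega>|M. iexp (S k \<omega> \<bullet> u)) - (CLINT \<omega>|M. iexp (X \<omega> \<bullet> u))) < r" if "K \<le> k" for k
    using bound [of k] that by fastforce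
  then show "\<exists>K. \<forall>k\<ge>K. norm ((CLINT \<omega>|M. iexp (S k \<omega> \<bullet> u)) - (CLINT \<omega>|M. iexp (X \<omega> \<bullet> u))) < r"
    by blast
qed

lemma has_stochastic_integralD:
  assumes "has_stochastic_integral M Z F 0 t X" and "0 \<le> t" and "0 < \<epsilon>"
  shows "(\<lambda>k. measure M {\<omega> \<in> space M.
    \<epsilon> < norm (riemann_sum Z F (Suc k) (uniform_partition t k) \<omega> - X \<omega>)}) \<longlonglongrightarrow> 0"
proof (rule LIMSEQ_I)
  fix r :: real assume "0 < r"
  then obtain \<delta> where "0 < \<delta>" and \<delta>: "\<And>(N::nat) s.
      s 0 = 0 \<and> s N = t \<and> (\<forall>i<N. s i \<le> s (Suc i) \<and> s (Suc i) - s i < \<delta>) \<Longrightarrow>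
      measure M {\<omega> \<in> space M. \<epsilon> < norm (riemann_sum Z F N s \<omega> - X \<omega>)} < r"
    using assms(1,3) unfolding has_stochastic_integral_def riemann_sum_def by blast
  have "\<forall>\<^sub>F k in sequentially. t / real (Suc k) < \<delta>"
    using LIMSEQ_divide_Suc \<open>0 < \<delta>\<close> by (rule order_tendstoD)
  then obtain K where K: "\<And>k. K \<le> k \<Longrightarrow> t / real (Suc k) < \<delta>"
    by (auto simp: eventually_sequentially simp del: of_nat_Suc)
  have "measure M {\<omega> \<in> space M. \<epsilon> < norm (riemann_sum Z F (Suc k) (uniform_partition t k) \<omega> - X \<omega>)} < r"
    if "K \<le> k" for k
    using K [OF that] by (intro \<delta>) (simp add: uniform_partition [OF \<open>0 \<le> t\<close>] del: of_nat_Suc)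
  then show "\<exists>K. \<forall>k\<ge>K. norm (measure M {\<omega> \<in> space M.
      \<epsilon> < norm (riemann_sum Z F (Suc k) (uniform_partition t k) \<omega> - X \<omega>)} - 0) < r"
    by auto
qed

lemma norm_matrix_vector_mult_le:
  fixes B :: "real ^ 'n ^ 'n"
  shows "norm (B *v x) \<le> (\<Sum>i\<in>UNIV. \<Sum>j\<in>UNIV. \<bar>B $ i $ j\<bar>) * norm x"
proof -
  have "\<bar>(B *v x) $ i\<bar> \<le> (\<Sum>j\<in>UNIV. \<bar>B $ i $ j\<bar>) * norm x" for i
  proof -
    have "\<bar>(B *v x) $ i\<bar> \<le> (\<Sum>j\<in>UNIV. \<bar>B $ i $ j\<bar> * \<bar>x $ j\<bar>)"
      by (simp add: matrix_vector_mult_def abs_mult [symmetric])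
    also have "\<dots> \<le> (\<Sum>j\<in>UNIV. \<bar>B $ i $ j\<bar> * norm x)"
      by (intro sum_mono mult_left_mono component_le_norm_cart) auto
    finally show ?thesis
      by (simp add: sum_distrib_right)
  qed
  then have "(\<Sum>i\<in>UNIV. \<bar>(B *v x) $ i\<bar>) \<le> (\<Sum>i\<in>UNIV. (\<Sum>j\<in>UNIV. \<bar>B $ i $ j\<bar>) * norm x)"
    by (intro sum_mono)
  with norm_le_l1_cart [of "B *v x"] show ?thesis
    by (simp add: sum_distrib_right)
qed

lemma inner_matrix_vector_mult_left:
  fixes B :: "real ^ 'n ^ 'n"
  shows "(B *v x) \<bullet> y = x \<bullet> (transpose B *v y)"
  using dot_lmul_matrix [of y B x] by (simp add: inner_commute)

text \<open>\<open>u \<bullet> u\<close> is the inner product of the inverse exponential applied to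
  \<open>u\<close> with the transposed exponential applied to \<open>u\<close>. The inverse is
  bounded uniformly over \<open>{0..t}\<close> by continuity.\<close>

lemma norm_transpose_matrix_exp_ge:
  fixes A :: "real ^ 'n ^ 'n"
  obtains \<kappa> where "0 < \<kappa>"
    "\<And>s u. 0 \<le> s \<Longrightarrow> s \<le> t \<Longrightarrow> \<kappa> * norm u \<le> norm (transpose (matrix_exp (s *\<^sub>R A)) *v u)"
proof -
  let ?E = "\<lambda>s. matrix_exp (s *\<^sub>R A)"
  let ?g = "\<lambda>s. \<Sum>i\<in>UNIV. \<Sum>j\<in>UNIV. \<bar>?E (- s) $ i $ j\<bar>"
  have "continuous_on {0..t} (\<lambda>s. ?E (- s))"
    by (rule continuous_on_compose2 [OF continuous_on_matrix_exp [of UNIV A]]) (auto intro: continuous_intros)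
  then have "continuous_on {0..t} ?g"
    by (intro continuous_intros)
  then have "bounded (?g ` {0..t})"
    by (intro compact_imp_bounded compact_continuous_image) auto
  then obtain K where K: "\<forall>y\<in>?g ` {0..t}. norm y \<le> K"
    unfolding bounded_iff ..
  show thesis
  proof
    \<comment> \<open>\<open>K\<close> can be negative when \<open>{0..t}\<close> is empty; the
      constant \<open>\<bar>K\<bar> + 1\<close> is positive in every case.\<close>
    show "0 < 1 / (\<bar>K\<bar> + 1)"
      by (simp add: add_nonneg_pos)
    fix s :: real and u :: "real ^ 'n" assume s: "0 \<le> s" "s \<le> t"
    have "?g s \<le> \<bar>K\<bar> + 1"
    proof -
      have "norm (?g s) \<le> K"
        using K s by auto
      then show ?thesis
        unfolding real_norm_def by linarith
    qed
    have "norm u * norm u = u \<bullet> u"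
      by (simp add: norm_eq_sqrt_inner)
    also have "\<dots> = u \<bullet> (?E s *v (?E (- s) *v u))"
      using matrix_exp_mult_uminus [of s A] by (simp add: matrix_vector_mul_assoc)
    also have "\<dots> = (?E (- s) *v u) \<bullet> (transpose (?E s) *v u)"
      by (subst inner_commute) (rule inner_matrix_vector_mult_left)
    also have "\<dots> \<le> norm (?E (- s) *v u) * norm (transpose (?E s) *v u)"
      by (rule norm_cauchy_schwarz)
    also have "\<dots> \<le> (?g s * norm u) * norm (transpose (?E s) *v u)"
      by (intro mult_right_mono norm_matrix_vector_mult_le) simp
    also have "\<dots> \<le> ((\<bar>K\<bar> + 1) * norm u) * norm (transpose (?E s) *v u)"
      using \<open>?g s \<le> \<bar>K\<bar> + 1\<close> by (intro mult_right_mono) auto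
    finally have le: "norm u * norm u \<le> norm u * ((\<bar>K\<bar> + 1) * norm (transpose (?E s) *v u))"
      by (simp add: mult_ac)
    show "1 / (\<bar>K\<bar> + 1) * norm u \<le> norm (transpose (?E s) *v u)"
    proof (cases "u = 0")
      case False
      then have "norm u \<le> (\<bar>K\<bar> + 1) * norm (transpose (?E s) *v u)"
        using mult_left_le_imp_le [OF le] by simp
      then show ?thesis
        by (simp add: pos_divide_le_eq add_nonneg_pos mult.commute)
    qed simp
  qed
qed

context nondegenerate_symmetric_stable_process
begin

text \<open>Transposition moves \<open>F\<close> from the increments onto \<open>u\<close>.
  Independence then factors the expectation, and stationarity turns each factor into a value of the
  characteristic function of \<open>Z\<close>.\<close>

lemma char_riemann_sum:
  assumes s: "0 \<le> s 0" "\<And>i. i < N \<Longrightarrow> s i \<le> s (Suc i)"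
  shows "(CLINT \<omega>|M. iexp (riemann_sum Z F N s \<omega> \<bullet> u)) =
    complex_of_real (exp (- (\<Sum>i<N. (s (Suc i) - s i) * \<psi> (transpose (F (s i)) *v u))))"
proof -
  let ?D = "\<lambda>i \<omega>. Z (s (Suc i)) \<omega> - Z (s i) \<omega>"
  let ?w = "\<lambda>i. transpose (F (s i)) *v u"
  have D_meas: "?D i \<in> borel_measurable M" if "i < N" for i
    using s(2) that partition_nonneg [of s N i, OF s] by (intro increment_measurable) auto
  have "(CLINT \<omega>|M. iexp (riemann_sum Z F N s \<omega> \<bullet> u)) = (CLINT \<omega>|M. (\<Prod>i<N. iexp (?D i \<omega> \<bullet> ?w i)))"
    by (simp add: riemann_sum_def inner_sum_left inner_matrix_vector_mult_left sum_distrib_left exp_sum)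
  also have "\<dots> = (\<Prod>i<N. CLINT \<omega>|M. iexp (?D i \<omega> \<bullet> ?w i))"
  proof (rule indep_vars_lebesgue_integral)
    have "indep_vars (\<lambda>_. borel) ?D {..<N}"
      by (rule independent_increments [OF s])
    then show "indep_vars (\<lambda>_. borel) (\<lambda>i \<omega>. iexp (?D i \<omega> \<bullet> ?w i)) {..<N}"
      by (rule indep_vars_compose2 [where Y = "\<lambda>i x. iexp (x \<bullet> ?w i)"]) measurable
    show "complex_integrable M (\<lambda>\<omega>. iexp (?D i \<omega> \<bullet> ?w i))" if "i \<in> {..<N}" for i
      using D_meas [of i] that by (intro integrable_iexp borel_measurable_inner borel_measurable_const) auto
  qed simp
  also have "\<dots> = (\<Prod>i<N. complex_of_real (exp (- ((s (Suc i) - s i) * \<psi> (?w i)))))"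
  proof (rule prod.cong [OF refl])
    fix i assume "i \<in> {..<N}"
    then have i: "i < N" "0 \<le> s i" "s i \<le> s (Suc i)"
      using s(2) partition_nonneg [of s N i, OF s] by auto
    define h where "h = s (Suc i) - s i"
    have h: "0 \<le> h" "s (Suc i) = s i + h"
      using i by (simp_all add: h_def)
    have Zh [measurable]: "Z h \<in> borel_measurable M"
      using h by (intro random_variable_Z)
    have "(CLINT \<omega>|M. iexp (?D i \<omega> \<bullet> ?w i)) = (CLINT x|distr M borel (?D i). iexp (x \<bullet> ?w i))"
      using D_meas [OF i(1)] by (subst integral_distr) simp_all
    also have "distr M borel (?D i) = distr M borel (Z h)"
      using stationary_increments [of "s i" h] i h by simp
    also have "(CLINT x|distr M borel (Z h). iexp (x \<bullet> ?w i)) = (CLINT \<omega>|M. iexp (Z h \<omega> \<bullet> ?w i))"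
      by (subst integral_distr) simp_all
    also have "\<dots> = exp (- complex_of_real h * complex_of_real (\<psi> (?w i)))"
      by (simp only: characteristic_function [OF h(1)] stable_exponent_eq)
    also have "\<dots> = complex_of_real (exp (- (h * \<psi> (?w i))))"
      by (simp flip: exp_of_real)
    finally show "(CLINT \<omega>|M. iexp (?D i \<omega> \<bullet> ?w i)) =
        complex_of_real (exp (- ((s (Suc i) - s i) * \<psi> (?w i))))"
      by (simp only: h_def)
  qed
  also have "\<dots> = complex_of_real (exp (- (\<Sum>i<N. (s (Suc i) - s i) * \<psi> (?w i))))"
    by (simp add: exp_sum flip: sum_negf)
  finally show ?thesis .
qed

text \<open>The Riemann sums have characteristic functions \<open>exp (- \<Psi> k u)\<close> with
  \<open>\<Psi> k\<close> even, homogeneous and bounded below uniformly in \<open>k\<close>. The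
  limit thus satisfies the conditions of \<open>symmetric_stable_law\<close>.\<close>

lemma measure_support_stochastic_integral:
  assumes \<alpha>: "0 < \<alpha>" "\<alpha> < 2" and t: "0 < t"
    and X: "has_stochastic_integral M Z F 0 t X"
    and \<kappa>: "0 < \<kappa>" "\<And>s u. 0 \<le> s \<Longrightarrow> s \<le> t \<Longrightarrow> \<kappa> * norm u \<le> norm (transpose (F s) *v u)"
  shows "measure_support (distr M borel X) = UNIV"
proof -
  obtain C where C: "0 < C" "\<And>u. C * norm u powr \<alpha> \<le> \<psi> u"
    using nondegenerate unfolding \<psi>_def by blast
  have t0: "0 \<le> t"
    using t by simp
  note part = uniform_partition [OF t0]
  have X_meas [measurable]: "X \<in> borel_measurable M"
    using X by (simp add: has_stochastic_integral_def)
  let ?P = "distr M borel X"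
  let ?s = "uniform_partition t"
  \<comment> \<open>A Riemann sum for the integral of \<open>\<psi> (transpose (F s) *v u)\<close>
    over \<open>s\<close>. Convergence of \<open>exp (- \<Psi> k u)\<close> comes from convergence
    in probability, not from this integral.\<close>
  define \<Psi> where "\<Psi> k u = (\<Sum>i<Suc k. t / real (Suc k) * \<psi> (transpose (F (?s k i)) *v u))" for k u
  define p where "p u = Re (vec_char ?P u)" for u
  have "(\<lambda>k. complex_of_real (exp (- \<Psi> k u))) \<longlonglongrightarrow> vec_char ?P u" for u
  proof -
    have "(\<lambda>k. CLINT \<omega>|M. iexp (riemann_sum Z F (Suc k) (?s k) \<omega> \<bullet> u)) \<longlonglongrightarrow> (CLINT \<omega>|M. iexp (X \<omega> \<bullet> u))"
      using part by (intro char_tendsto_in_prob riemann_sum_measurable X_meas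
          has_stochastic_integralD [OF X t0]) simp_all
    moreover have "(CLINT \<omega>|M. iexp (riemann_sum Z F (Suc k) (?s k) \<omega> \<bullet> u)) =
        complex_of_real (exp (- \<Psi> k u))" for k
      using part by (subst char_riemann_sum) (simp_all add: \<Psi>_def del: of_nat_Suc sum.lessThan_Suc)
    moreover have "vec_char ?P u = (CLINT \<omega>|M. iexp (X \<omega> \<bullet> u))"
      unfolding vec_char_def by (subst integral_distr) simp_all
    ultimately show ?thesis
      by simp
  qed note lim = this
  have p_lim: "(\<lambda>k. exp (- \<Psi> k u)) \<longlonglongrightarrow> p u" for u
    using tendsto_Re [OF lim [of u]] by (simp add: p_def)
  have char: "vec_char ?P u = complex_of_real (p u)" for u
    using LIMSEQ_unique [OF lim tendsto_of_real [OF p_lim]] .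
  have \<Psi>_minus: "\<Psi> k (- u) = \<Psi> k u" for k u
  proof -
    have "B *v (- u) = - (B *v u)" for B :: "real ^ 'b ^ 'b"
      by (simp add: linear_neg)
    then show ?thesis
      by (simp add: \<Psi>_def \<psi>_minus)
  qed
  have \<Psi>_scaleR: "\<Psi> k (a *\<^sub>R u) = a powr \<alpha> * \<Psi> k u" if "0 < a" for a k u
    using that by (simp add: \<Psi>_def matrix_vector_mult_scaleR \<psi>_scaleR sum_distrib_left mult_ac
        del: of_nat_Suc sum.lessThan_Suc)
  \<comment> \<open>Each summand is bounded by non-degeneracy together with the bound by
    \<open>\<kappa>\<close>; the \<open>Suc k\<close> weights \<open>t / Suc k\<close> add up to
    \<open>t\<close>.\<close>
  have \<Psi>_ge: "t * C * \<kappa> powr \<alpha> * norm u powr \<alpha> \<le> \<Psi> k u" for k u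
  proof -
    have "C * \<kappa> powr \<alpha> * norm u powr \<alpha> \<le> \<psi> (transpose (F (?s k i)) *v u)" if "i < Suc k" for i
    proof -
      have "?s k i \<le> t"
        using partition_mono [of "Suc k" "?s k" i "Suc k"] part that by simp
      then have "\<kappa> * norm u \<le> norm (transpose (F (?s k i)) *v u)"
        using part by (intro \<kappa>)
      then have "C * (\<kappa> * norm u) powr \<alpha> \<le> C * norm (transpose (F (?s k i)) *v u) powr \<alpha>"
        using C \<alpha> \<kappa> by (intro mult_left_mono powr_mono2) auto
      also have "\<dots> \<le> \<psi> (transpose (F (?s k i)) *v u)"
        by (rule C)
      finally show ?thesis
        using \<kappa> by (simp add: powr_mult mult.assoc)
    qed
    then have "(\<Sum>i<Suc k. t / real (Suc k) * (C * \<kappa> powr \<alpha> * norm u powr \<alpha>)) \<le> \<Psi> k u"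
      unfolding \<Psi>_def using t by (intro sum_mono mult_left_mono) auto
    then show ?thesis
      by (simp add: mult_ac del: of_nat_Suc)
  qed
  interpret law: symmetric_stable_law ?P \<alpha> "t * C * \<kappa> powr \<alpha>" p
  proof (intro symmetric_stable_law.intro symmetric_stable_law_axioms.intro)
    show "prob_space ?P"
      by (rule prob_space_distr) simp
    show "p (- u) = p u" for u
      using LIMSEQ_unique [OF p_lim [of "- u"]] p_lim [of u] by (simp add: \<Psi>_minus)
    show "p (a *\<^sub>R u) * p (b *\<^sub>R u) = p u" if "0 < a" "0 < b" "a powr \<alpha> + b powr \<alpha> = 1" for a b u
    proof (rule LIMSEQ_unique [OF tendsto_mult [OF p_lim p_lim]])
      have "exp (- \<Psi> k (a *\<^sub>R u)) * exp (- \<Psi> k (b *\<^sub>R u)) = exp (- \<Psi> k u)" for k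
      proof -
        have "\<Psi> k (a *\<^sub>R u) + \<Psi> k (b *\<^sub>R u) = (a powr \<alpha> + b powr \<alpha>) * \<Psi> k u"
          by (simp only: \<Psi>_scaleR [OF that(1)] \<Psi>_scaleR [OF that(2)] distrib_right)
        then have "\<Psi> k (a *\<^sub>R u) + \<Psi> k (b *\<^sub>R u) = \<Psi> k u"
          by (simp only: that(3) mult_1)
        then show ?thesis
          by (simp flip: exp_add)
      qed
      then show "(\<lambda>k. exp (- \<Psi> k (a *\<^sub>R u)) * exp (- \<Psi> k (b *\<^sub>R u))) \<longlonglongrightarrow> p u"
        using p_lim by simp
    qed
    show "p u \<le> exp (- (t * C * \<kappa> powr \<alpha>) * norm u powr \<alpha>)" for u
      using \<Psi>_ge by (intro LIMSEQ_le_const2 [OF p_lim]) auto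
  qed (use \<alpha> t C \<kappa> char in simp_all)
  show ?thesis
    by (rule law.supp_eq_UNIV)
qed

end

section \<open>Irreducibility of the Ornstein-Uhlenbeck process\<close>

theorem theorem3p4:
  fixes M :: "'w measure"
    and Z :: "real \<Rightarrow> 'w \<Rightarrow> real ^ 'n"
    and \<alpha> :: real
    and \<mu> :: "(real ^ 'n) measure"
    and A :: "real ^ 'n ^ 'n"
  assumes "0 < \<alpha>" and "\<alpha> < 2"
    and "nondegenerate_symmetric_stable_process M Z \<alpha> \<mu>"
  shows "irreducible_process M (ornstein_uhlenbeck M Z A)"
  unfolding irreducible_process_def
proof (intro allI impI)
  fix t :: real assume t: "0 < t"
  interpret nondegenerate_symmetric_stable_process M Z \<alpha> \<mu> by fact
  let ?F = "\<lambda>s. matrix_exp ((t - s) *\<^sub>R A)"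
  have "((\<lambda>s. ?F s $ i $ j) has_real_derivative (- (A ** ?F s)) $ i $ j) (at s)" for s i j
    using DERIV_chain' [OF DERIV_diff [OF DERIV_const DERIV_ident] has_real_derivative_matrix_exp [of A i j "t - s"]]
    by simp
  moreover have "continuous_on UNIV (\<lambda>s. (- (A ** ?F s)) $ i $ j)" for i j
  proof -
    have "continuous_on UNIV ?F"
      by (rule continuous_on_compose2 [OF continuous_on_matrix_exp [of UNIV A]]) (auto intro!: continuous_intros)
    then show ?thesis
      unfolding matrix_matrix_mult_def by (auto intro!: continuous_intros)
  qed
  ultimately have "\<exists>X. has_stochastic_integral M Z ?F 0 t X"
    using t by (intro has_stochastic_integral_exists [where F' = "\<lambda>s. - (A ** ?F s)"]) simp_all
  \<comment> \<open>Existence guarantees that the \<open>SOME\<close> in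
    \<open>stochastic_integral\<close> picks an actual integral.\<close>
  then have X: "has_stochastic_integral M Z ?F 0 t (ornstein_uhlenbeck M Z A t)"
    unfolding ornstein_uhlenbeck_def stochastic_integral_def by (rule someI_ex)
  obtain \<kappa> where \<kappa>: "0 < \<kappa>"
    "\<And>s u. 0 \<le> s \<Longrightarrow> s \<le> t \<Longrightarrow> \<kappa> * norm u \<le> norm (transpose (matrix_exp (s *\<^sub>R A)) *v u)"
    using norm_transpose_matrix_exp_ge by blast
  \<comment> \<open>The integrand uses the exponential at time \<open>t - s\<close>, which stays in
    \<open>{0..t}\<close>, so the same \<open>\<kappa>\<close> serves.\<close>
  show "measure_support (distr M borel (ornstein_uhlenbeck M Z A t)) = UNIV"
    by (rule measure_support_stochastic_integral [OF assms(1,2) t X \<kappa>(1)]) (rule \<kappa>(2); simp)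
qed

end
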